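(* $\nabla$ is the Levi-Civita connection for the metric $(-,-)$ (and, when $\mathbb K=\mathbb C$, for the hermitian metric $\langle-,-\rangle$ on tangent vectors) on every component of $\mathbb P_{\mathbb K}V\setminus SV$.
   Context: $\mathbb K$ is $\mathbb R$, $\mathbb C$ or $\mathbb H$ (quaternions). $V$ is a finite-dimensional right $\mathbb K$-vector space with a nondegenerate hermitian form $\langle-,-\rangle$: it takes values in $\mathbb K$, is biadditive, and satisfies $\langle v_1k,v_2\rangle=\overline k\langle v_1,v_2\rangle$, $\langle v_1,v_2k\rangle=\langle v_1,v_2\rangle k$, $\langle v_1,v_2\rangle=\overline{\langle v_2,v_1\rangle}$. A point of $\mathbb P_{\mathbb K}V$, a representative in $V$, and the corresponding one-dimensional subspace are denoted by the same letter. A point $p$ is isotropic if $\langle p,p\rangle=0$; $SV$ is the set of isotropic points. For $p$ nonisotropic, $\pi'[p]v:=p\frac{\langle p,v\rangle}{\langle p,p\rangle}$ and $\pi[p]v:=v-\pi'[p]v$ are the orthogonal projections onto $p$ and $p^\perp$, and $T_p\mathbb P_{\mathbb K}V=\mathrm{Lin}_{\mathbb K}(p,p^\perp)$, where $\varphi:p\to p^\perp$ corresponds to the derivation $f\mapsto\frac{d}{d\varepsilon}|_{\varepsilon=0}\hat f(p+\varepsilon\varphi p)$, $\hat f$ being the lift of $f$ to $V\setminus\{0\}$. Extending by zero on $p^\perp$, tangent vectors at $p$ are regarded as elements of $\mathrm{Lin}_{\mathbb K}(V,V)$. For $t_1,t_2\in T_p\mathbb P_{\mathbb K}V$ the metric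 is $(t_1,t_2):=\pm\frac{\mathrm{tr}_{\mathbb R}(t_1^*t_2)}{\dim_{\mathbb R}\mathbb K}$, and for $\mathbb K=\mathbb C$ the hermitian metric is $\langle t_1,t_2\rangle:=\pm\mathrm{tr}_{\mathbb C}(t_1^*t_2)$ (one of the signs being fixed), where $t_1^*$ is the adjoint with respect to the hermitian form on $V$. For $t\in\mathrm{Lin}_{\mathbb K}(V,V)$ put $t_p:=\pi[p]\,t\,\pi'[p]$. A lifted field over an open set $U\subset V$ without isotropic points and with $U\mathbb K^*\subset U$ is a smooth map $X:U\to\mathrm{Lin}_{\mathbb K}(V,V)$ with $X(p)_p=X(p)$ and $X(pk)=X(p)$ for all $p\in U$, $k\in\mathbb K^*$; lifted fields are the same as smooth tangent fields over $\mathbb P_{\mathbb K}U$. For $t\in\mathrm{Lin}_{\mathbb K}(V,V)$ and a lifted field $X$, $\nabla_tX(p):=\Big(\frac{d}{d\varepsilon}\Big|_{\varepsilon=0}X\big((1+\varepsilon t)p\big)\Big)_p$, and $\nabla_YX(p):=\nabla_{Y(p)}X(p)$ for a lifted field $Y$. Being Levi-Civita for the (hermitian) metric means: $\nabla$ is an affine connection that is torsion-free, $\nabla_ST-\nabla_TS=[S,T]$, and compatible with the (hermitian) metric, $v(S,T)=(\nabla_vS,T)+(S,\nabla_vT)$ (respectively, the same with the hermitian metric $\langle-,-\rangle$), for all smooth tangent fields $S,T$ and tangent vectors $v$. *)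

theory Defs
  imports "HOL-Analysis.Analysis"
begin

section \<open>Scalars\<close>

text \<open>
  The properties of conjugation shared by the real numbers, the complex numbers and the
  quaternions. Only these three instances are used in the end.
\<close>

class conj_division_algebra = real_div_algebra +
  fixes kconj :: "'a \<Rightarrow> 'a"
  assumes kconj_add: "kconj (x + y) = kconj x + kconj y"
    and kconj_mult: "kconj (x * y) = kconj y * kconj x"
    and kconj_scaleR: "kconj (scaleR r x) = scaleR r (kconj x)"
    and kconj_kconj: "kconj (kconj x) = x"
    and kconj_fixed: "kconj x = x \<Longrightarrow> \<exists>r. x = scaleR r 1"

instantiation real :: conj_division_algebra
begin
definition kconj_real :: "real \<Rightarrow> real" where "kconj_real x = x"
instance by standard (auto simp: kconj_real_def)
end

instantiation complex :: conj_division_algebra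
begin
definition kconj_complex :: "complex \<Rightarrow> complex" where "kconj_complex = cnj"
instance
  by standard (auto simp: kconj_complex_def complex_eq_iff)
end

datatype quat = Quat (qre: real) (qi: real) (qj: real) (qk: real)

lemma quat_eq_iff: "x = y \<longleftrightarrow> qre x = qre y \<and> qi x = qi y \<and> qj x = qj y \<and> qk x = qk y"
  by (cases x; cases y) auto

instantiation quat :: conj_division_algebra
begin

definition zero_quat :: quat where "0 = Quat 0 0 0 0"
definition one_quat :: quat where "1 = Quat 1 0 0 0"
definition plus_quat :: "quat \<Rightarrow> quat \<Rightarrow> quat" where
  "x + y = Quat (qre x + qre y) (qi x + qi y) (qj x + qj y) (qk x + qk y)"
definition minus_quat :: "quat \<Rightarrow> quat \<Rightarrow> quat" where
  "x - y = Quat (qre x - qre y) (qi x - qi y) (qj x - qj y) (qk x - qk y)"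
definition uminus_quat :: "quat \<Rightarrow> quat" where
  "- x = Quat (- qre x) (- qi x) (- qj x) (- qk x)"
definition times_quat :: "quat \<Rightarrow> quat \<Rightarrow> quat" where
  "x * y = Quat
     (qre x * qre y - qi x * qi y - qj x * qj y - qk x * qk y)
     (qre x * qi y + qi x * qre y + qj x * qk y - qk x * qj y)
     (qre x * qj y - qi x * qk y + qj x * qre y + qk x * qi y)
     (qre x * qk y + qi x * qj y - qj x * qi y + qk x * qre y)"
definition scaleR_quat :: "real \<Rightarrow> quat \<Rightarrow> quat" where
  "scaleR r x = Quat (r * qre x) (r * qi x) (r * qj x) (r * qk x)"
definition kconj_quat :: "quat \<Rightarrow> quat" where
  "kconj x = Quat (qre x) (- qi x) (- qj x) (- qk x)"
definition inverse_quat :: "quat \<Rightarrow> quat" where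
  "inverse x = scaleR (1 / ((qre x)\<^sup>2 + (qi x)\<^sup>2 + (qj x)\<^sup>2 + (qk x)\<^sup>2)) (kconj x)"
definition divide_quat :: "quat \<Rightarrow> quat \<Rightarrow> quat" where
  "divide_quat x y = x * inverse y"

lemmas quat_defs = zero_quat_def one_quat_def plus_quat_def minus_quat_def uminus_quat_def
  times_quat_def scaleR_quat_def kconj_quat_def

lemma quat_normsq_pos:
  assumes "x \<noteq> (0::quat)"
  shows "(qre x)\<^sup>2 + (qi x)\<^sup>2 + (qj x)\<^sup>2 + (qk x)\<^sup>2 > 0"
proof -
  have "(qre x)\<^sup>2 > 0 \<or> (qi x)\<^sup>2 > 0 \<or> (qj x)\<^sup>2 > 0 \<or> (qk x)\<^sup>2 > 0"
    using assms by (auto simp: quat_eq_iff zero_quat_def)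
  moreover have "(qre x)\<^sup>2 \<ge> 0" "(qi x)\<^sup>2 \<ge> 0" "(qj x)\<^sup>2 \<ge> 0" "(qk x)\<^sup>2 \<ge> 0"
    by simp_all
  ultimately show ?thesis by linarith
qed

instance
proof
  fix x y z :: quat and r s :: real
  let ?n = "(qre x)\<^sup>2 + (qi x)\<^sup>2 + (qj x)\<^sup>2 + (qk x)\<^sup>2"
  show "x * y * z = x * (y * z)"
    by (simp add: quat_eq_iff quat_defs algebra_simps)
  show "x + y + z = x + (y + z)" "x + y = y + x" "0 + x = x" "- x + x = 0" "x - y = x + - y"
    "1 * x = x" "x * 1 = x" "(x + y) * z = x * z + y * z" "x * (y + z) = x * y + x * z"
    "(0::quat) \<noteq> 1"
    by (simp_all add: quat_eq_iff quat_defs algebra_simps)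
  show "r *\<^sub>R (x + y) = r *\<^sub>R x + r *\<^sub>R y" "(r + s) *\<^sub>R x = r *\<^sub>R x + s *\<^sub>R x"
    "r *\<^sub>R s *\<^sub>R x = (r * s) *\<^sub>R x" "1 *\<^sub>R x = x"
    "r *\<^sub>R x * y = r *\<^sub>R (x * y)" "x * r *\<^sub>R y = r *\<^sub>R (x * y)"
    by (simp_all add: quat_eq_iff quat_defs algebra_simps)
  show "kconj (x + y) = kconj x + kconj y" "kconj (x * y) = kconj y * kconj x"
    "kconj (r *\<^sub>R x) = r *\<^sub>R kconj x" "kconj (kconj x) = x"
    by (simp_all add: quat_eq_iff quat_defs algebra_simps)
  show "\<exists>r. x = r *\<^sub>R 1" if "kconj x = x"
    using that by (auto simp: quat_eq_iff quat_defs)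
  have cx: "kconj x * x = ?n *\<^sub>R 1" "x * kconj x = ?n *\<^sub>R 1"
    by (simp_all add: quat_eq_iff quat_defs power2_eq_square algebra_simps)
  have sc: "r *\<^sub>R a * b = r *\<^sub>R (a * b)" "b * r *\<^sub>R a = r *\<^sub>R (b * a)"
    "r *\<^sub>R s *\<^sub>R a = (r * s) *\<^sub>R a" "1 *\<^sub>R a = a" for a b :: quat and r s
    by (simp_all add: quat_eq_iff quat_defs algebra_simps)
  show "inverse x * x = 1" "x * inverse x = 1" if "x \<noteq> 0"
    using quat_normsq_pos[OF that] unfolding inverse_quat_def sc cx by (simp_all add: sc)
  show "x div y = x * inverse y" by (fact divide_quat_def)
  show "inverse (0::quat) = 0"
    by (simp add: inverse_quat_def quat_eq_iff quat_defs)
qed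

end


section \<open>Smooth maps and traces\<close>

text \<open>
  On an open subset of a finite-dimensional space, \<open>smooth_on\<close> is the class \<open>C\<^sup>\<infinity>\<close>: all
  iterated directional derivatives exist and are differentiable.
\<close>

primrec differentiable_upto ::
  "nat \<Rightarrow> 'a::real_normed_vector set \<Rightarrow> ('a \<Rightarrow> 'b::real_normed_vector) \<Rightarrow> bool" where
  "differentiable_upto 0 S f \<longleftrightarrow> continuous_on S f"
| "differentiable_upto (Suc n) S f \<longleftrightarrow>
     (\<forall>x\<in>S. f differentiable (at x)) \<and>
     (\<forall>v. differentiable_upto n S (\<lambda>x. frechet_derivative f (at x) v))"

definition smooth_on ::
  "'a::real_normed_vector set \<Rightarrow> ('a \<Rightarrow> 'b::real_normed_vector) \<Rightarrow> bool" where
  "smooth_on S f \<longleftrightarrow> (\<forall>n. differentiable_upto n S f)"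

definition is_basis :: "('k::field \<Rightarrow> 'v::ab_group_add \<Rightarrow> 'v) \<Rightarrow> 'v set \<Rightarrow> bool" where
  "is_basis scl B \<longleftrightarrow> finite B \<and> \<not> module.dependent scl B \<and> module.span scl B = UNIV"

text \<open>The trace does not depend on the chosen basis.\<close>

definition trace_over :: "('k::field \<Rightarrow> 'v::ab_group_add \<Rightarrow> 'v) \<Rightarrow> ('v \<Rightarrow> 'v) \<Rightarrow> 'k" where
  "trace_over scl f =
     (let B = (SOME B. is_basis scl B) in \<Sum>b\<in>B. module.representation scl B (f b) b)"


section \<open>Hermitian spaces and their projective spaces\<close>

text \<open>
  The type \<open>'v\<close> provides the underlying real vector space of \<open>V\<close>, of finite dimension, with its
  usual topology and smooth structure; its inner product is unrelated to the hermitian form.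
  Points of the projective space are represented by vectors of \<open>V\<close>, subsets of it by unions of
  lines without the origin, and functions and tangent fields on it by their lifts.
\<close>

locale hermitian_space =
  fixes act :: "'v::euclidean_space \<Rightarrow> 'k::conj_division_algebra \<Rightarrow> 'v"  (infixl "\<cdot>" 75)
    and form :: "'v \<Rightarrow> 'v \<Rightarrow> 'k"  ("\<langle>_, _\<rangle>")
  assumes act_add_left: "(v + w) \<cdot> k = v \<cdot> k + w \<cdot> k"
    and act_add_right: "v \<cdot> (k + l) = v \<cdot> k + v \<cdot> l"
    and act_act: "v \<cdot> k \<cdot> l = v \<cdot> (k * l)"
    and act_of_real: "v \<cdot> of_real r = r *\<^sub>R v"
    and form_add_left: "\<langle>v + v', w\<rangle> = \<langle>v, w\<rangle> + \<langle>v', w\<rangle>"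
    and form_add_right: "\<langle>v, w + w'\<rangle> = \<langle>v, w\<rangle> + \<langle>v, w'\<rangle>"
    and form_act_left: "\<langle>v \<cdot> k, w\<rangle> = kconj k * \<langle>v, w\<rangle>"
    and form_act_right: "\<langle>v, w \<cdot> k\<rangle> = \<langle>v, w\<rangle> * k"
    and form_conj: "\<langle>v, w\<rangle> = kconj \<langle>w, v\<rangle>"
    and form_nondegenerate: "(\<And>w. \<langle>v, w\<rangle> = 0) \<Longrightarrow> v = 0"
begin

definition line :: "'v \<Rightarrow> 'v set" where
  "line p = range (\<lambda>k. p \<cdot> k)"

definition PV :: "'v set set" where
  "PV = line ` {p. p \<noteq> 0}"

definition SV :: "'v set set" where
  "SV = line ` {p. p \<noteq> 0 \<and> \<langle>p, p\<rangle> = 0}"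

definition cone :: "'v set set \<Rightarrow> 'v set" where
  "cone C = {p. p \<noteq> 0 \<and> line p \<in> C}"

text \<open>The quotient topology.\<close>

definition PV_topology :: "'v set topology" where
  "PV_topology = topology (\<lambda>C. C \<subseteq> PV \<and> open (cone C))"

lemma openin_PV_topology: "openin PV_topology C \<longleftrightarrow> C \<subseteq> PV \<and> open (cone C)"
proof -
  have "istopology (\<lambda>C. C \<subseteq> PV \<and> open (cone C))"
    unfolding istopology_def
  proof (intro conjI allI impI)
    fix S T assume "S \<subseteq> PV \<and> open (cone S)" "T \<subseteq> PV \<and> open (cone T)"
    moreover have "cone (S \<inter> T) = cone S \<inter> cone T" by (auto simp: cone_def)
    ultimately show "S \<inter> T \<subseteq> PV" "open (cone (S \<inter> T))" by auto
  next
    fix K assume "\<forall>S\<in>K. S \<subseteq> PV \<and> open (cone S)"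
    moreover have "cone (\<Union>K) = \<Union>(cone ` K)" by (auto simp: cone_def)
    ultimately show "\<Union>K \<subseteq> PV" "open (cone (\<Union>K))" by auto
  qed
  then show ?thesis by (simp add: PV_topology_def topology_inverse')
qed

definition nonisotropic_components :: "'v set set set" where
  "nonisotropic_components = connected_components_of (subtopology PV_topology (PV - SV))"

definition klinear :: "('v \<Rightarrow>\<^sub>L 'v) \<Rightarrow> bool" where
  "klinear t \<longleftrightarrow> (\<forall>v k. blinfun_apply t (v \<cdot> k) = blinfun_apply t v \<cdot> k)"

definition proj_line :: "'v \<Rightarrow> ('v \<Rightarrow>\<^sub>L 'v)" where
  "proj_line p = Blinfun (\<lambda>v. p \<cdot> (\<langle>p, v\<rangle> / \<langle>p, p\<rangle>))"

definition proj_perp :: "'v \<Rightarrow> ('v \<Rightarrow>\<^sub>L 'v)" where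
  "proj_perp p = id_blinfun - proj_line p"

text \<open>The map \<open>t\<^sub>p\<close>.\<close>

definition at_point :: "'v \<Rightarrow> ('v \<Rightarrow>\<^sub>L 'v) \<Rightarrow> ('v \<Rightarrow>\<^sub>L 'v)" where
  "at_point p t = proj_perp p o\<^sub>L t o\<^sub>L proj_line p"

text \<open>\<open>Lin(p, p\<^sup>\<bottom>)\<close>, whose elements are extended by zero on \<open>p\<^sup>\<bottom>\<close>.\<close>

definition tangent_space :: "'v \<Rightarrow> ('v \<Rightarrow>\<^sub>L 'v) set" where
  "tangent_space p = {t. klinear t \<and> \<langle>p, blinfun_apply t p\<rangle> = 0 \<and>
     (\<forall>v. \<langle>p, v\<rangle> = 0 \<longrightarrow> blinfun_apply t v = 0)}"

text \<open>The derivative of a function along the tangent vector \<open>t\<close> at \<open>p\<close>.\<close>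

definition tderiv :: "'v \<Rightarrow> ('v \<Rightarrow>\<^sub>L 'v) \<Rightarrow> ('v \<Rightarrow> 'w::real_normed_vector) \<Rightarrow> 'w" where
  "tderiv p t f = vector_derivative (\<lambda>\<epsilon>. f (p + \<epsilon> *\<^sub>R blinfun_apply t p)) (at 0)"

definition region :: "'v set \<Rightarrow> bool" where
  "region U \<longleftrightarrow> open U \<and> (\<forall>p\<in>U. \<langle>p, p\<rangle> \<noteq> 0) \<and> (\<forall>p\<in>U. \<forall>k. k \<noteq> 0 \<longrightarrow> p \<cdot> k \<in> U)"

definition smooth_function :: "'v set \<Rightarrow> ('v \<Rightarrow> real) \<Rightarrow> bool" where
  "smooth_function U f \<longleftrightarrow> smooth_on U f \<and> (\<forall>p\<in>U. \<forall>k. k \<noteq> 0 \<longrightarrow> f (p \<cdot> k) = f p)"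

definition lifted_field :: "'v set \<Rightarrow> ('v \<Rightarrow> ('v \<Rightarrow>\<^sub>L 'v)) \<Rightarrow> bool" where
  "lifted_field U X \<longleftrightarrow> smooth_on U X \<and>
     (\<forall>p\<in>U. klinear (X p) \<and> at_point p (X p) = X p \<and> (\<forall>k. k \<noteq> 0 \<longrightarrow> X (p \<cdot> k) = X p))"

text \<open>\<open>nabla p t X\<close> is the value of \<open>\<nabla>\<^sub>t X\<close> at \<open>p\<close>.\<close>

definition nabla :: "'v \<Rightarrow> ('v \<Rightarrow>\<^sub>L 'v) \<Rightarrow> ('v \<Rightarrow> ('v \<Rightarrow>\<^sub>L 'v)) \<Rightarrow> ('v \<Rightarrow>\<^sub>L 'v)" where
  "nabla p t X = at_point p
     (vector_derivative (\<lambda>\<epsilon>. X (blinfun_apply (id_blinfun + \<epsilon> *\<^sub>R t) p)) (at 0))"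

definition hadjoint :: "('v \<Rightarrow>\<^sub>L 'v) \<Rightarrow> ('v \<Rightarrow>\<^sub>L 'v)" where
  "hadjoint t = (THE s. \<forall>v w. \<langle>blinfun_apply t v, w\<rangle> = \<langle>v, blinfun_apply s w\<rangle>)"

text \<open>The parameter \<open>\<sigma>\<close> is the sign in front of the trace.\<close>

definition metric :: "real \<Rightarrow> ('v \<Rightarrow>\<^sub>L 'v) \<Rightarrow> ('v \<Rightarrow>\<^sub>L 'v) \<Rightarrow> real" where
  "metric \<sigma> s t =
     \<sigma> * (trace_over scaleR (blinfun_apply (hadjoint s o\<^sub>L t)) / real (dim (UNIV :: 'k set)))"


subsection \<open>Levi-Civita connections\<close>

text \<open>
  Below, \<open>M\<close> is the union of the lines (without the origin) forming an open subset of the projective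
  space, and \<open>D p t X\<close> is the covariant derivative at \<open>p\<close> of the tangent field \<open>X\<close> along the tangent
  vector \<open>t\<close>. As fields over \<open>U\<close> are total functions in HOL, a connection is required not to depend
  on their values outside \<open>U\<close>.
\<close>

definition affine_connection ::
  "'v set \<Rightarrow> ('v \<Rightarrow> ('v \<Rightarrow>\<^sub>L 'v) \<Rightarrow> ('v \<Rightarrow> ('v \<Rightarrow>\<^sub>L 'v)) \<Rightarrow> ('v \<Rightarrow>\<^sub>L 'v)) \<Rightarrow> bool" where
  "affine_connection M D \<longleftrightarrow>
     (\<forall>U X. region U \<and> U \<subseteq> M \<and> lifted_field U X \<longrightarrow>
        (\<forall>Y. lifted_field U Y \<longrightarrow> lifted_field U (\<lambda>p. D p (Y p) X)) \<and>
        (\<forall>p\<in>U. \<forall>t\<in>tangent_space p.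
           D p t X \<in> tangent_space p \<and>
           (\<forall>s\<in>tangent_space p. D p (s + t) X = D p s X + D p t X) \<and>
           (\<forall>a. D p (a *\<^sub>R t) X = a *\<^sub>R D p t X) \<and>
           (\<forall>Z. lifted_field U Z \<longrightarrow> D p t (\<lambda>q. X q + Z q) = D p t X + D p t Z) \<and>
           (\<forall>f. smooth_function U f \<longrightarrow>
              D p t (\<lambda>q. f q *\<^sub>R X q) = tderiv p t f *\<^sub>R X p + f p *\<^sub>R D p t X) \<and>
           (\<forall>Z. lifted_field U Z \<and> (\<forall>q\<in>U. Z q = X q) \<longrightarrow> D p t Z = D p t X)))"

text \<open>
  \<open>is_lie_bracket U S T B\<close> says that \<open>B = [S, T]\<close> as derivations of functions over \<open>U\<close> and its
  open parts.
\<close>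

definition is_lie_bracket :: "'v set \<Rightarrow> ('v \<Rightarrow> ('v \<Rightarrow>\<^sub>L 'v)) \<Rightarrow> ('v \<Rightarrow> ('v \<Rightarrow>\<^sub>L 'v)) \<Rightarrow>
    ('v \<Rightarrow> ('v \<Rightarrow>\<^sub>L 'v)) \<Rightarrow> bool" where
  "is_lie_bracket U S T B \<longleftrightarrow> lifted_field U B \<and>
     (\<forall>W f. region W \<and> W \<subseteq> U \<and> smooth_function W f \<longrightarrow>
        (\<forall>p\<in>W. tderiv p (B p) f =
           tderiv p (S p) (\<lambda>q. tderiv q (T q) f) - tderiv p (T p) (\<lambda>q. tderiv q (S q) f)))"

definition torsion_free ::
  "'v set \<Rightarrow> ('v \<Rightarrow> ('v \<Rightarrow>\<^sub>L 'v) \<Rightarrow> ('v \<Rightarrow> ('v \<Rightarrow>\<^sub>L 'v)) \<Rightarrow> ('v \<Rightarrow>\<^sub>L 'v)) \<Rightarrow> bool" where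
  "torsion_free M D \<longleftrightarrow>
     (\<forall>U S T. region U \<and> U \<subseteq> M \<and> lifted_field U S \<and> lifted_field U T \<longrightarrow>
        is_lie_bracket U S T (\<lambda>p. D p (S p) T - D p (T p) S))"

definition metric_compatible ::
  "'v set \<Rightarrow> (('v \<Rightarrow>\<^sub>L 'v) \<Rightarrow> ('v \<Rightarrow>\<^sub>L 'v) \<Rightarrow> 'w::real_normed_vector) \<Rightarrow>
   ('v \<Rightarrow> ('v \<Rightarrow>\<^sub>L 'v) \<Rightarrow> ('v \<Rightarrow> ('v \<Rightarrow>\<^sub>L 'v)) \<Rightarrow> ('v \<Rightarrow>\<^sub>L 'v)) \<Rightarrow> bool" where
  "metric_compatible M g D \<longleftrightarrow>
     (\<forall>U S T. region U \<and> U \<subseteq> M \<and> lifted_field U S \<and> lifted_field U T \<longrightarrow>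
        (\<forall>p\<in>U. \<forall>v\<in>tangent_space p.
           tderiv p v (\<lambda>q. g (S q) (T q)) = g (D p v S) (T p) + g (S p) (D p v T)))"

definition levi_civita ::
  "'v set \<Rightarrow> (('v \<Rightarrow>\<^sub>L 'v) \<Rightarrow> ('v \<Rightarrow>\<^sub>L 'v) \<Rightarrow> 'w::real_normed_vector) \<Rightarrow>
   ('v \<Rightarrow> ('v \<Rightarrow>\<^sub>L 'v) \<Rightarrow> ('v \<Rightarrow> ('v \<Rightarrow>\<^sub>L 'v)) \<Rightarrow> ('v \<Rightarrow>\<^sub>L 'v)) \<Rightarrow> bool" where
  "levi_civita M g D \<longleftrightarrow> affine_connection M D \<and> torsion_free M D \<and> metric_compatible M g D"

definition nabla_levi_civita ::
  "(real \<Rightarrow> ('v \<Rightarrow>\<^sub>L 'v) \<Rightarrow> ('v \<Rightarrow>\<^sub>L 'v) \<Rightarrow> 'w::real_normed_vector) \<Rightarrow> bool" where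
  "nabla_levi_civita g \<longleftrightarrow>
     (\<forall>C\<in>nonisotropic_components. \<forall>\<sigma>\<in>{1, -1}. levi_civita (cone C) (g \<sigma>) nabla)"

end

locale complex_hermitian_space =
  hermitian_space act form
  for act :: "'v::euclidean_space \<Rightarrow> complex \<Rightarrow> 'v" and form :: "'v \<Rightarrow> 'v \<Rightarrow> complex"
begin

definition hermitian_metric :: "real \<Rightarrow> ('v \<Rightarrow>\<^sub>L 'v) \<Rightarrow> ('v \<Rightarrow>\<^sub>L 'v) \<Rightarrow> complex" where
  "hermitian_metric \<sigma> s t =
     of_real \<sigma> * trace_over (\<lambda>k v. act v k) (blinfun_apply (hadjoint s o\<^sub>L t))"

end

end

theory Submission
  imports Defs
begin

text \<open>
  Tangent fields are lifted to operator-valued functions on cones in \<open>V\<close>, so everything can be computed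
  with ordinary derivatives there. Since \<open>(1 + \<epsilon> t) p = p + \<epsilon> t p\<close>, the value of \<open>\<nabla>\<^sub>t X\<close> at \<open>p\<close> is the
  tangent part \<open>(DX(t p))\<^sub>p\<close> of the derivative of the lift \<open>X\<close> in the direction \<open>t p\<close> (\<open>nabla_eq\<close>). The axioms
  of an affine connection follow from those of the derivative, together with the smoothness of
  \<open>p \<mapsto> \<pi>'[p]\<close> away from isotropic points and its invariance under rescaling of \<open>p\<close>
  (\<open>affine_connection_nabla\<close>).

  There is no torsion because second derivatives commute: for a function \<open>f\<close> that is constant along
  lines, \<open>S(T f)\<close> is the Hessian of \<open>f\<close> at \<open>S p\<close> and \<open>T p\<close>, plus \<open>Df(DT(S p) p)\<close>, plus \<open>Df(T (S p))\<close>. The first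
  is symmetric in \<open>S\<close> and \<open>T\<close>. The last is zero, as \<open>T\<close> kills \<open>p\<^sup>\<bottom>\<close>, which contains \<open>S p\<close>. The middle one
  does not change when \<open>DT(S p)\<close> is replaced by its tangent part, because the two differ at \<open>p\<close> by a
  multiple of \<open>p\<close>, along which \<open>Df\<close> vanishes (\<open>torsion_free_nabla\<close>).

  The metrics have the form \<open>\<tau>(s\<^sup>* t)\<close> with a functional \<open>\<tau>\<close> satisfying \<open>\<tau>(a b) = \<tau>(b a)\<close>, namely a multiple
  of the trace over the real or over the complex numbers. The product rule yields compatibility up to
  taking tangent parts, and these change nothing: for tangent \<open>t\<close>,
  \<open>\<tau>((\<pi> s \<pi>')\<^sup>* t) = \<tau>(\<pi>' s\<^sup>* \<pi> t) = \<tau>(s\<^sup>* \<pi> t \<pi>') = \<tau>(s\<^sup>* t)\<close> (\<open>metric_compatible_nabla\<close>). To differentiate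
  \<open>s\<^sup>* t\<close>, the adjoint has to exist and to depend smoothly on \<open>s\<close>; both are obtained from the adjoint with
  respect to the real part of the hermitian form, which is nondegenerate over the reals
  (\<open>form_real_adjoint\<close>, \<open>bounded_linear_real_adjoint\<close>).

  The argument is local and makes no difference between the scalars or between the two signs.
\<close>

section \<open>Smooth maps\<close>

lemma differentiable_upto_cong:
  assumes "open S" "\<And>x. x \<in> S \<Longrightarrow> f x = g x" "differentiable_upto n S f"
  shows "differentiable_upto n S g"
  using assms(2,3)
proof (induction n arbitrary: f g)
  case 0
  then show ?case by (simp cong: continuous_on_cong)
next
  case (Suc n)
  have fd: "frechet_derivative f (at x) = frechet_derivative g (at x)" if "x \<in> S" for x
    using frechet_derivative_transform_within_open[OF _ assms(1) that] Suc.prems that by auto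
  have "g differentiable (at x)" if "x \<in> S" for x
    using Suc.prems that assms(1) has_derivative_transform_within_open
    unfolding differentiable_def differentiable_upto.simps by metis
  moreover have "differentiable_upto n S (\<lambda>x. frechet_derivative g (at x) v)" for v
  proof (rule Suc.IH)
    show "frechet_derivative f (at x) v = frechet_derivative g (at x) v" if "x \<in> S" for x
      by (simp only: fd[OF that])
    show "differentiable_upto n S (\<lambda>x. frechet_derivative f (at x) v)"
      using Suc.prems(2) unfolding differentiable_upto.simps by blast
  qed
  ultimately show ?case by simp
qed

lemma differentiable_upto_SucD:
  assumes "differentiable_upto (Suc n) S f"
  shows "differentiable_upto n S f"
  using assms
proof (induction n arbitrary: f)
  case 0
  then show ?case
    by (auto intro!: continuous_at_imp_continuous_on differentiable_imp_continuous_within)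
next
  case (Suc n)
  from Suc.prems have f: "\<forall>x\<in>S. f differentiable (at x)"
    and "differentiable_upto (Suc n) S (\<lambda>x. frechet_derivative f (at x) v)" for v
    unfolding differentiable_upto.simps(2)[of "Suc n"] by blast+
  from Suc.IH[OF this(2)] f show ?case by simp
qed

text \<open>
  The recursion in the definition uses the Frechet derivative selected by description. This rule lets
  one use any function that is a derivative at the points of \<open>S\<close>; openness of \<open>S\<close> makes the
  values outside irrelevant.
\<close>

lemma differentiable_upto_SucI:
  assumes "open S"
    and "\<And>x. x \<in> S \<Longrightarrow> (f has_derivative f' x) (at x)"
    and "\<And>v. differentiable_upto n S (\<lambda>x. f' x v)"
  shows "differentiable_upto (Suc n) S f"
proof -
  have "differentiable_upto n S (\<lambda>x. frechet_derivative f (at x) v)" for v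
    by (rule differentiable_upto_cong[OF assms(1) _ assms(3)[of v]])
      (use frechet_derivative_at[OF assms(2)] in metis)
  then show ?thesis
    using assms(2) by (auto intro: differentiableI)
qed

lemma differentiable_upto_const: "differentiable_upto n S (\<lambda>x. c)"
  by (induction n arbitrary: c) auto

lemma differentiable_upto_ident: "differentiable_upto n S (\<lambda>x. x)"
  by (cases n) (auto simp: differentiable_upto_const)

lemma differentiable_uptoD:
  assumes "differentiable_upto (Suc n) S f"
  shows "x \<in> S \<Longrightarrow> (f has_derivative frechet_derivative f (at x)) (at x)"
    and "differentiable_upto n S (\<lambda>x. frechet_derivative f (at x) v)"
    and "differentiable_upto n S f"
  using assms differentiable_upto_SucD[OF assms]
  unfolding differentiable_upto.simps(2)[of n] frechet_derivative_works[symmetric] by blast+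

lemma differentiable_upto_add:
  assumes "open S" "differentiable_upto n S f" "differentiable_upto n S g"
  shows "differentiable_upto n S (\<lambda>x. f x + g x)"
  using assms(2,3)
proof (induction n arbitrary: f g)
  case 0
  then show ?case by (simp add: continuous_on_add)
next
  case (Suc n)
  show ?case
  proof (rule differentiable_upto_SucI[OF assms(1) has_derivative_add])
    show "differentiable_upto n S
        (\<lambda>x. frechet_derivative f (at x) v + frechet_derivative g (at x) v)" for v
      by (intro Suc.IH differentiable_uptoD[OF Suc.prems(1)] differentiable_uptoD[OF Suc.prems(2)])
  qed (rule differentiable_uptoD(1)[OF Suc.prems(1)] differentiable_uptoD(1)[OF Suc.prems(2)],
      assumption)+
qed

text \<open>
  Product rule: the derivative is again a sum of products, one order of differentiability lower, so
  the induction closes once \<open>f\<close> and \<open>g\<close> are generalised.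
\<close>

lemma differentiable_upto_bilinear:
  assumes "bounded_bilinear B" "open S" "differentiable_upto n S f" "differentiable_upto n S g"
  shows "differentiable_upto n S (\<lambda>x. B (f x) (g x))"
  using assms(3,4)
proof (induction n arbitrary: f g)
  case 0
  then show ?case using bounded_bilinear.continuous_on[OF assms(1)] by auto
next
  case (Suc n)
  show ?case
  proof (rule differentiable_upto_SucI[OF assms(2) bounded_bilinear.FDERIV[OF assms(1)]])
    show "differentiable_upto n S (\<lambda>x. B (f x) (frechet_derivative g (at x) v) +
        B (frechet_derivative f (at x) v) (g x))" for v
      by (intro differentiable_upto_add assms(2) Suc.IH differentiable_uptoD[OF Suc.prems(1)]
          differentiable_uptoD[OF Suc.prems(2)])
  qed (rule differentiable_uptoD(1)[OF Suc.prems(1)] differentiable_uptoD(1)[OF Suc.prems(2)],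
      assumption)+
qed

lemma differentiable_upto_inverse:
  fixes f :: "'a::real_normed_vector \<Rightarrow> real"
  assumes "open S" "\<And>x. x \<in> S \<Longrightarrow> f x \<noteq> 0" "differentiable_upto n S f"
  shows "differentiable_upto n S (\<lambda>x. inverse (f x))"
  using assms(3)
proof (induction n)
  case 0
  then show ?case using assms(2) by (simp add: continuous_on_inverse)
next
  case (Suc n)
  show ?case
  proof (rule differentiable_upto_SucI[OF assms(1)])
    show "((\<lambda>x. inverse (f x)) has_derivative
        (\<lambda>v. (- 1) * (inverse (f x) * frechet_derivative f (at x) v * inverse (f x)))) (at x)"
      if "x \<in> S" for x
      using Deriv.has_derivative_inverse[OF assms(2)[OF that] differentiable_uptoD(1)[OF Suc.prems that]]
      by simp
    show "differentiable_upto n S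
        (\<lambda>x. (- 1) * (inverse (f x) * frechet_derivative f (at x) v * inverse (f x)))" for v
      by (intro differentiable_upto_bilinear[OF bounded_bilinear_mult] assms(1)
          differentiable_upto_const Suc.IH differentiable_uptoD[OF Suc.prems])
  qed
qed

lemma smooth_on_cong:
  assumes "open S" "\<And>x. x \<in> S \<Longrightarrow> f x = g x" "smooth_on S f"
  shows "smooth_on S g"
  using assms differentiable_upto_cong unfolding smooth_on_def by blast

lemma smooth_on_imp_continuous_on: "smooth_on S f \<Longrightarrow> continuous_on S f"
  unfolding smooth_on_def by (metis differentiable_upto.simps(1))

lemma smooth_on_imp_has_derivative:
  assumes "smooth_on S f" "x \<in> S"
  shows "(f has_derivative frechet_derivative f (at x)) (at x)"
  using assms differentiable_uptoD(1) unfolding smooth_on_def by blast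

lemma smooth_on_frechet_derivative:
  assumes "smooth_on S f"
  shows "smooth_on S (\<lambda>x. frechet_derivative f (at x) v)"
  using assms differentiable_uptoD(2) unfolding smooth_on_def by blast

lemma smooth_on_const: "smooth_on S (\<lambda>x. c)"
  and smooth_on_ident: "smooth_on S (\<lambda>x. x)"
  by (simp_all add: smooth_on_def differentiable_upto_const differentiable_upto_ident)

lemma smooth_on_add:
  assumes "open S" "smooth_on S f" "smooth_on S g"
  shows "smooth_on S (\<lambda>x. f x + g x)"
  using assms differentiable_upto_add unfolding smooth_on_def by blast

lemma smooth_on_bilinear:
  assumes "bounded_bilinear B" "open S" "smooth_on S f" "smooth_on S g"
  shows "smooth_on S (\<lambda>x. B (f x) (g x))"
  using assms differentiable_upto_bilinear unfolding smooth_on_def by blast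

lemma smooth_on_inverse:
  fixes f :: "'a::real_normed_vector \<Rightarrow> real"
  assumes "open S" "smooth_on S f" "\<And>x. x \<in> S \<Longrightarrow> f x \<noteq> 0"
  shows "smooth_on S (\<lambda>x. inverse (f x))"
  using assms differentiable_upto_inverse unfolding smooth_on_def by blast

lemma smooth_on_sum:
  assumes "open S" "\<And>i. i \<in> I \<Longrightarrow> smooth_on S (f i)"
  shows "smooth_on S (\<lambda>x. \<Sum>i\<in>I. f i x)"
  using assms(2)
proof (induction I rule: infinite_finite_induct)
  case (insert i I)
  then show ?case using assms(1) by (auto intro!: smooth_on_add)
qed (auto simp: smooth_on_const)

lemma smooth_on_diff:
  assumes "open S" "smooth_on S f" "smooth_on S g"
  shows "smooth_on S (\<lambda>x. f x - g x)"
proof -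
  have "smooth_on S (\<lambda>x. (- 1) *\<^sub>R g x)"
    by (intro smooth_on_bilinear[OF bounded_bilinear_scaleR] smooth_on_const assms)
  from smooth_on_add[OF assms(1,2) this] show ?thesis by simp
qed

lemma frechet_derivative_euclidean_sum:
  fixes f :: "'a::euclidean_space \<Rightarrow> 'b::real_normed_vector"
  assumes "f differentiable (at x)"
  shows "frechet_derivative f (at x) v = (\<Sum>b\<in>Basis. (v \<bullet> b) *\<^sub>R frechet_derivative f (at x) b)"
proof -
  interpret linear "frechet_derivative f (at x)" by (rule linear_frechet_derivative[OF assms])
  have "frechet_derivative f (at x) (\<Sum>b\<in>Basis. (v \<bullet> b) *\<^sub>R b) =
      (\<Sum>b\<in>Basis. (v \<bullet> b) *\<^sub>R frechet_derivative f (at x) b)"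
    by (simp add: sum scale)
  then show ?thesis by (simp add: euclidean_representation)
qed

text \<open>
  In finite dimension the derivative along a varying direction is a finite combination of derivatives
  along fixed basis directions, with coefficients that are smooth.
\<close>

lemma smooth_on_derivative_along_field:
  fixes f :: "'a::euclidean_space \<Rightarrow> 'b::real_normed_vector"
  assumes S: "open S" and f: "smooth_on S f" and w: "smooth_on S w"
  shows "smooth_on S (\<lambda>x. frechet_derivative f (at x) (w x))"
proof (rule smooth_on_cong[OF S])
  show "smooth_on S (\<lambda>x. \<Sum>b\<in>Basis. (w x \<bullet> b) *\<^sub>R frechet_derivative f (at x) b)"
    by (intro smooth_on_sum smooth_on_bilinear[OF bounded_bilinear_scaleR] S
        smooth_on_bilinear[OF bounded_bilinear_inner] smooth_on_const w
        smooth_on_frechet_derivative[OF f])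
  show "(\<Sum>b\<in>Basis. (w x \<bullet> b) *\<^sub>R frechet_derivative f (at x) b) =
      frechet_derivative f (at x) (w x)" if "x \<in> S" for x
    using frechet_derivative_euclidean_sum[OF differentiableI[OF smooth_on_imp_has_derivative[OF f that]], of "w x"]
    by simp
qed

lemma smooth_on_bounded_linear:
  assumes "bounded_linear L" "open S" "smooth_on S f"
  shows "smooth_on S (\<lambda>x. L (f x))"
proof -
  have "bounded_bilinear (\<lambda>r x. r *\<^sub>R L x)"
    by (rule bounded_bilinear.comp[OF bounded_bilinear_scaleR bounded_linear_ident assms(1)])
  from smooth_on_bilinear[OF this assms(2) smooth_on_const[of S 1] assms(3)] show ?thesis by simp
qed

lemma bounded_bilinear_rank_one:
  "bounded_bilinear (\<lambda>(u::'b::real_normed_vector) v. (v \<bullet> (b::'a::euclidean_space)) *\<^sub>R u)"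
  by (rule bounded_bilinear.flip)
    (rule bounded_bilinear.comp[OF bounded_bilinear_scaleR bounded_linear_inner_left bounded_linear_ident])

text \<open>
  An operator is the sum over the basis of the rank-one operators built from its columns, so an
  operator-valued map is as smooth as its columns.
\<close>

lemma smooth_on_blinfunI:
  fixes X :: "'c::real_normed_vector \<Rightarrow> ('a::euclidean_space \<Rightarrow>\<^sub>L 'b::real_normed_vector)"
  assumes S: "open S" and X: "\<And>b. b \<in> Basis \<Longrightarrow> smooth_on S (\<lambda>x. blinfun_apply (X x) b)"
  shows "smooth_on S X"
proof -
  let ?R = "\<lambda>b. bounded_bilinear.prod_right (\<lambda>(u::'b) v. (v \<bullet> (b::'a)) *\<^sub>R u)"
  have "(\<Sum>b\<in>Basis. ?R b (blinfun_apply (X x) b)) = X x" for x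
  proof (rule blinfun_eqI)
    fix v
    have "blinfun_apply (\<Sum>b\<in>Basis. ?R b (blinfun_apply (X x) b)) v =
        blinfun_apply (X x) (\<Sum>b\<in>Basis. (v \<bullet> b) *\<^sub>R b)"
      by (simp add: blinfun.sum_left blinfun.sum_right blinfun.scaleR_right
          bounded_bilinear.prod_right.rep_eq[OF bounded_bilinear_rank_one])
    then show "blinfun_apply (\<Sum>b\<in>Basis. ?R b (blinfun_apply (X x) b)) v = blinfun_apply (X x) v"
      by (simp only: euclidean_representation)
  qed
  moreover have "smooth_on S (\<lambda>x. \<Sum>b\<in>Basis. ?R b (blinfun_apply (X x) b))"
    by (intro smooth_on_sum smooth_on_bounded_linear[OF
          bounded_bilinear.bounded_linear_prod_right[OF bounded_bilinear_rank_one]] S X)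
  ultimately show ?thesis by (simp only:)
qed

lemma has_vector_derivative_along_line:
  assumes "(f has_derivative f') (at p)"
  shows "((\<lambda>\<epsilon>. f (p + \<epsilon> *\<^sub>R w)) has_vector_derivative f' w) (at 0)"
proof -
  have "((\<lambda>\<epsilon>. p + \<epsilon> *\<^sub>R w) has_derivative (\<lambda>\<epsilon>. \<epsilon> *\<^sub>R w)) (at 0)"
    by (auto intro!: derivative_eq_intros)
  moreover have "(f has_derivative f') (at (p + (0::real) *\<^sub>R w))" using assms by simp
  ultimately have "((\<lambda>\<epsilon>. f (p + \<epsilon> *\<^sub>R w)) has_derivative (\<lambda>\<epsilon>. f' (\<epsilon> *\<^sub>R w))) (at 0)"
    by (rule has_derivative_compose)
  then show ?thesis
    using linear_scale[OF has_derivative_linear[OF assms]] by (simp add: has_vector_derivative_def)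
qed

lemma has_field_derivative_along_line:
  fixes f :: "'a::real_normed_vector \<Rightarrow> real"
  assumes "(f has_derivative f') (at (q + s *\<^sub>R u))"
  shows "((\<lambda>s. f (q + s *\<^sub>R u)) has_field_derivative f' u) (at s)"
proof -
  have "((\<lambda>s. q + s *\<^sub>R u) has_derivative (\<lambda>s. s *\<^sub>R u)) (at s)"
    by (auto intro!: derivative_eq_intros)
  then have "((\<lambda>s. f (q + s *\<^sub>R u)) has_derivative (\<lambda>s. f' (s *\<^sub>R u))) (at s)"
    using assms by (rule has_derivative_compose)
  moreover have "(\<lambda>s. f' (s *\<^sub>R u)) = (*) (f' u)"
    using linear_scale[OF has_derivative_linear[OF assms]] by (auto simp: mult.commute)
  ultimately show ?thesis by (simp add: has_field_derivative_def)
qed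

section \<open>Symmetry of second derivatives\<close>

text \<open>
  Applying the mean value theorem first along \<open>u\<close> and then along \<open>v\<close> turns the second difference
  into \<open>h\<^sup>2\<close> times the mixed derivative at a nearby point; continuity moves that point to \<open>p\<close>.
\<close>

lemma second_difference_quotient:
  fixes f :: "'a::real_normed_vector \<Rightarrow> real" and p u v :: 'a
  assumes S: "open S" "p \<in> S" and f: "smooth_on S f" and e: "e > 0"
  defines "H \<equiv> \<lambda>x. frechet_derivative (\<lambda>x. frechet_derivative f (at x) u) (at x) v"
  shows "\<exists>r>0. \<forall>h. 0 < h \<and> h < r \<longrightarrow>
    \<bar>f (p + h *\<^sub>R u + h *\<^sub>R v) - f (p + h *\<^sub>R u) - f (p + h *\<^sub>R v) + f p - h * (h * H p)\<bar> \<le> e * (h * h)"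
proof -
  have fu: "smooth_on S (\<lambda>x. frechet_derivative f (at x) u)"
    by (rule smooth_on_frechet_derivative[OF f])
  have "isCont H p"
    using smooth_on_imp_continuous_on[OF smooth_on_frechet_derivative[OF fu, of v]] S
    unfolding H_def continuous_on_eq_continuous_at[OF S(1)] by blast
  then obtain d1 where d1: "d1 > 0" "\<And>x. dist x p < d1 \<Longrightarrow> dist (H x) (H p) < e"
    using e unfolding continuous_at_eps_delta by blast
  obtain d2 where d2: "d2 > 0" "ball p d2 \<subseteq> S"
    using S unfolding open_contains_ball by blast
  \<comment> \<open>The step \<open>h\<close> is bounded so that every point met below is closer to \<open>p\<close> than \<open>d\<close>.\<close>
  define d where "d = min d1 d2"
  define r where "r = d / (1 + norm u + norm v)"
  have pos: "1 + norm u + norm v > 0" by (simp add: add_pos_nonneg)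
  have d: "d > 0" using d1 d2 by (simp add: d_def)
  have near: "p + s *\<^sub>R u + t *\<^sub>R v \<in> S \<and> dist (p + s *\<^sub>R u + t *\<^sub>R v) p < d1"
    if "0 \<le> s" "s \<le> h" "0 \<le> t" "t \<le> h" "h < r" for s t h
  proof -
    have "norm (s *\<^sub>R u + t *\<^sub>R v) \<le> h * norm u + h * norm v"
      using that by (intro norm_triangle_le add_mono) (auto intro: mult_right_mono)
    also have "\<dots> \<le> h * (1 + norm u + norm v)" using that by (simp add: algebra_simps)
    also have "\<dots> < r * (1 + norm u + norm v)" using that pos by simp
    also have "\<dots> = d" using pos by (simp add: r_def)
    finally have "norm (s *\<^sub>R u + t *\<^sub>R v) < d" .
    then have "dist (p + s *\<^sub>R u + t *\<^sub>R v) p < d" by (simp add: dist_norm add.assoc)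
    then have "dist (p + s *\<^sub>R u + t *\<^sub>R v) p < d1" "p + s *\<^sub>R u + t *\<^sub>R v \<in> ball p d2"
      by (simp_all add: d_def dist_commute)
    then show ?thesis using d2(2) by blast
  qed
  have "\<bar>f (p + h *\<^sub>R u + h *\<^sub>R v) - f (p + h *\<^sub>R u) - f (p + h *\<^sub>R v) + f p - h * (h * H p)\<bar> \<le> e * (h * h)"
    if h: "0 < h" "h < r" for h
  proof -
    let ?\<phi> = "\<lambda>s. f (p + h *\<^sub>R v + s *\<^sub>R u) - f (p + s *\<^sub>R u)"
    let ?\<phi>' = "\<lambda>s. frechet_derivative f (at (p + h *\<^sub>R v + s *\<^sub>R u)) u -
      frechet_derivative f (at (p + s *\<^sub>R u)) u"
    have "(?\<phi> has_field_derivative ?\<phi>' s) (at s)" if "0 \<le> s" "s \<le> h" for s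
    proof -
      have "p + h *\<^sub>R v + s *\<^sub>R u \<in> S" "p + s *\<^sub>R u \<in> S"
        using near[OF that, of h] near[OF that, of 0] h by (simp_all add: ac_simps)
      then show ?thesis
        by (intro DERIV_diff has_field_derivative_along_line smooth_on_imp_has_derivative[OF f])
    qed
    from MVT2[OF h(1) this] obtain s where s: "0 < s" "s < h" "?\<phi> h - ?\<phi> 0 = (h - 0) * ?\<phi>' s"
      by blast
    let ?\<psi> = "\<lambda>t. frechet_derivative f (at (p + s *\<^sub>R u + t *\<^sub>R v)) u"
    have "(?\<psi> has_field_derivative H (p + s *\<^sub>R u + t *\<^sub>R v)) (at t)" if "0 \<le> t" "t \<le> h" for t
    proof -
      have "p + s *\<^sub>R u + t *\<^sub>R v \<in> S" using near[of s h t] h s that by simp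
      then show ?thesis
        unfolding H_def
        by (intro has_field_derivative_along_line smooth_on_imp_has_derivative[OF fu])
    qed
    from MVT2[OF h(1) this] obtain t where t: "0 < t" "t < h"
      "?\<psi> h - ?\<psi> 0 = (h - 0) * H (p + s *\<^sub>R u + t *\<^sub>R v)"
      by blast
    have "?\<phi>' s = h * H (p + s *\<^sub>R u + t *\<^sub>R v)" using t(3) by (simp add: algebra_simps)
    then have "f (p + h *\<^sub>R u + h *\<^sub>R v) - f (p + h *\<^sub>R u) - f (p + h *\<^sub>R v) + f p
        = h * (h * H (p + s *\<^sub>R u + t *\<^sub>R v))"
      using s(3) by (simp add: ac_simps)
    then have "f (p + h *\<^sub>R u + h *\<^sub>R v) - f (p + h *\<^sub>R u) - f (p + h *\<^sub>R v) + f p - h * (h * H p)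
        = (H (p + s *\<^sub>R u + t *\<^sub>R v) - H p) * (h * h)"
      by (simp add: algebra_simps)
    moreover have "\<bar>H (p + s *\<^sub>R u + t *\<^sub>R v) - H p\<bar> \<le> e"
      using d1(2)[of "p + s *\<^sub>R u + t *\<^sub>R v"] near[of s h t] s t h by (simp add: dist_real_def)
    ultimately show ?thesis using h by (simp add: abs_mult mult_right_mono)
  qed
  moreover have "r > 0" using d pos by (simp add: r_def)
  ultimately show ?thesis by blast
qed

text \<open>
  The second difference is unchanged when \<open>u\<close> and \<open>v\<close> are exchanged, whereas the two limits of its
  quotient by \<open>h\<^sup>2\<close> are the two mixed derivatives.
\<close>

lemma second_derivative_symmetric:
  fixes f :: "'a::real_normed_vector \<Rightarrow> real"
  assumes S: "open S" "p \<in> S" and f: "smooth_on S f"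
  shows "frechet_derivative (\<lambda>x. frechet_derivative f (at x) u) (at p) v =
    frechet_derivative (\<lambda>x. frechet_derivative f (at x) v) (at p) u" (is "?a = ?b")
proof (rule ccontr)
  assume ne: "?a \<noteq> ?b"
  \<comment> \<open>With a third of the gap on each side, the common second difference cannot be near both values.\<close>
  define e where "e = \<bar>?a - ?b\<bar> / 3"
  have e: "e > 0" using ne by (simp add: e_def)
  obtain r1 where r1: "r1 > 0" "\<And>h. 0 < h \<Longrightarrow> h < r1 \<Longrightarrow>
    \<bar>f (p + h *\<^sub>R u + h *\<^sub>R v) - f (p + h *\<^sub>R u) - f (p + h *\<^sub>R v) + f p - h * (h * ?a)\<bar> \<le> e * (h * h)"
    using second_difference_quotient[OF S f e, of u v] by blast
  obtain r2 where r2: "r2 > 0" "\<And>h. 0 < h \<Longrightarrow> h < r2 \<Longrightarrow>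
    \<bar>f (p + h *\<^sub>R v + h *\<^sub>R u) - f (p + h *\<^sub>R v) - f (p + h *\<^sub>R u) + f p - h * (h * ?b)\<bar> \<le> e * (h * h)"
    using second_difference_quotient[OF S f e, of v u] by blast
  define h where "h = min r1 r2 / 2"
  have h: "0 < h" "h < r1" "h < r2" using r1(1) r2(1) by (auto simp: h_def)
  have "f (p + h *\<^sub>R v + h *\<^sub>R u) = f (p + h *\<^sub>R u + h *\<^sub>R v)" by (simp add: algebra_simps)
  with r1(2)[OF h(1,2)] r2(2)[OF h(1,3)]
  have "\<bar>h * (h * ?a) - h * (h * ?b)\<bar> \<le> 2 * e * (h * h)" by linarith
  moreover have "h * (h * ?a) - h * (h * ?b) = (?a - ?b) * (h * h)" by (simp add: algebra_simps)
  ultimately have "3 * e * (h * h) \<le> 2 * e * (h * h)"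
    using h by (simp add: abs_mult e_def)
  then show False using e h by simp
qed

text \<open>
  Differentiating \<open>Df(w)\<close> gives one term from the field \<open>w\<close> and the Hessian of \<open>f\<close>. Symmetry of the
  Hessian puts the latter into a form in which \<open>w\<close> is frozen at \<open>p\<close>; in the commutator of two fields
  these Hessian terms cancel by the same symmetry.
\<close>

lemma has_derivative_derivative_along_field:
  fixes f :: "'a::euclidean_space \<Rightarrow> real"
  assumes S: "open S" "p \<in> S" and f: "smooth_on S f" and w: "(w has_derivative w') (at p)"
  shows "((\<lambda>q. frechet_derivative f (at q) (w q)) has_derivative
    (\<lambda>u. frechet_derivative f (at p) (w' u) +
      frechet_derivative (\<lambda>q. frechet_derivative f (at q) (w p)) (at p) u)) (at p)"
proof -
  let ?D = "\<lambda>v q. frechet_derivative f (at q) v"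
  have euc: "?D v q = (\<Sum>b\<in>Basis. (v \<bullet> b) * ?D b q)" if "q \<in> S" for v q
    using frechet_derivative_euclidean_sum[OF differentiableI[OF smooth_on_imp_has_derivative[OF f that]], of v]
    by simp
  have D: "(?D v has_derivative frechet_derivative (?D v) (at p)) (at p)" for v
    by (rule smooth_on_imp_has_derivative[OF smooth_on_frechet_derivative[OF f] S(2)])
  have "((\<lambda>q. \<Sum>b\<in>Basis. (w q \<bullet> b) * ?D b q) has_derivative
      (\<lambda>u. \<Sum>b\<in>Basis. (w p \<bullet> b) * frechet_derivative (?D b) (at p) u + (w' u \<bullet> b) * ?D b p)) (at p)"
    by (intro has_derivative_sum has_derivative_mult has_derivative_inner_left w D)
  moreover have "(\<Sum>b\<in>Basis. (w p \<bullet> b) * frechet_derivative (?D b) (at p) u + (w' u \<bullet> b) * ?D b p) =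
      ?D (w' u) p + frechet_derivative (?D (w p)) (at p) u" for u
  proof -
    have "(\<Sum>b\<in>Basis. (w p \<bullet> b) * frechet_derivative (?D b) (at p) u) =
        (\<Sum>b\<in>Basis. (w p \<bullet> b) * frechet_derivative (?D u) (at p) b)"
      by (intro sum.cong refl arg_cong2[where f = times] second_derivative_symmetric[OF S f])
    also have "\<dots> = frechet_derivative (?D u) (at p) (w p)"
      using frechet_derivative_euclidean_sum[OF differentiableI[OF D], of u "w p"] by simp
    also have "\<dots> = frechet_derivative (?D (w p)) (at p) u"
      by (rule second_derivative_symmetric[OF S f])
    finally show ?thesis by (simp only: sum.distrib euc[OF S(2), of "w' u"] add.commute)
  qed
  ultimately have "((\<lambda>q. \<Sum>b\<in>Basis. (w q \<bullet> b) * ?D b q) has_derivative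
      (\<lambda>u. ?D (w' u) p + frechet_derivative (?D (w p)) (at p) u)) (at p)"
    by (simp only:)
  then show ?thesis
    by (rule has_derivative_transform_within_open[OF _ S]) (rule euc[symmetric])
qed

section \<open>Traces\<close>

context vector_space
begin

lemma trace_over_basis:
  assumes "\<exists>B. is_basis scale B"
  obtains B where "finite B" "independent B" "span B = UNIV"
    "\<And>f. trace_over scale f = (\<Sum>b\<in>B. representation B (f b) b)"
proof -
  have "is_basis scale (SOME B. is_basis scale B)"
    by (rule someI_ex[OF assms])
  then show ?thesis
    by (intro that[of "SOME B. is_basis scale B"]) (auto simp: is_basis_def trace_over_def Let_def)
qed

text \<open>
  In coordinates with respect to a basis, both sides are the double sum of the products
  of matrix entries.
\<close>

lemma trace_over_commute:
  assumes basis: "\<exists>B. is_basis scale B"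
    and f: "module_hom scale scale f" and g: "module_hom scale scale g"
  shows "trace_over scale (\<lambda>v. f (g v)) = trace_over scale (\<lambda>v. g (f v))"
proof -
  obtain B where B: "finite B" "independent B" "span B = UNIV"
    and tr: "\<And>f. trace_over scale f = (\<Sum>b\<in>B. representation B (f b) b)"
    using trace_over_basis[OF basis] by blast
  have rep: "representation B (f (g b)) b =
      (\<Sum>c\<in>B. representation B (g b) c * representation B (f c) b)"
    if f: "module_hom scale scale f" for f g :: "'b \<Rightarrow> 'b" and b
  proof -
    interpret f: module_hom scale scale f by (rule f)
    have "f (g b) = f (\<Sum>c\<in>B. scale (representation B (g b) c) c)"
      using B by (subst sum_representation_eq) auto
    also have "\<dots> = (\<Sum>c\<in>B. scale (representation B (g b) c) (f c))"
      by (simp only: f.sum f.scale)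
    finally have "representation B (f (g b)) =
        representation B (\<Sum>c\<in>B. scale (representation B (g b) c) (f c))"
      by (rule arg_cong)
    also have "\<dots> = (\<lambda>b'. \<Sum>c\<in>B. representation B (scale (representation B (g b) c) (f c)) b')"
      using B by (intro representation_sum) auto
    also have "\<dots> = (\<lambda>b'. \<Sum>c\<in>B. representation B (g b) c * representation B (f c) b')"
      by (simp add: representation_scale[OF B(2)] B(3))
    finally show ?thesis by (rule fun_cong)
  qed
  show ?thesis
    unfolding tr rep[OF f, of g] rep[OF g, of f] by (subst sum.swap) (simp only: mult.commute)
qed

end

text \<open>
  A set that is independent over the larger field is independent over the reals, hence finite.
\<close>

lemma finite_basis_exists_euclidean:
  fixes scl :: "'k::real_field \<Rightarrow> 'v::euclidean_space \<Rightarrow> 'v"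
  assumes "vector_space scl" and real: "\<And>r v. scl (of_real r) v = r *\<^sub>R v"
  shows "\<exists>B. is_basis scl B"
proof -
  interpret s: vector_space scl by fact
  obtain B where B: "s.independent B" "UNIV \<subseteq> s.span B"
    using s.basis_exists[of UNIV] by blast
  have "independent B"
  proof
    assume "dependent B"
    then obtain t u v where t: "finite t" "t \<subseteq> B" "(\<Sum>v\<in>t. u v *\<^sub>R v) = 0" "v \<in> t" "u v \<noteq> 0"
      unfolding dependent_explicit by blast
    have "(\<Sum>v\<in>t. scl (of_real (u v)) v) = 0" using t(3) by (simp add: real)
    then have "of_real (u v) = (0::'k)"
      using B(1)[unfolded s.independent_explicit_module, rule_format, of t "\<lambda>v. of_real (u v)" v] t
      by blast
    then show False using t(5) by simp
  qed
  then have "finite B" by (simp add: independent_bound)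
  then show ?thesis using B unfolding is_basis_def by blast
qed

text \<open>
  Over any of the fields, the trace is real linear and continuous. This is what allows
  differentiating under it.
\<close>

lemma bounded_linear_trace_over:
  fixes scl :: "'k::real_normed_field \<Rightarrow> 'v::euclidean_space \<Rightarrow> 'v"
  assumes scl: "vector_space scl" and real: "\<And>r v. scl (of_real r) v = r *\<^sub>R v"
  shows "bounded_linear (\<lambda>t::'v \<Rightarrow>\<^sub>L 'v. trace_over scl (blinfun_apply t))"
proof -
  interpret s: vector_space scl by fact
  obtain B where B: "finite B" "s.independent B" "s.span B = UNIV"
    and tr: "\<And>f. trace_over scl f = (\<Sum>b\<in>B. s.representation B (f b) b)"
    using s.trace_over_basis[OF finite_basis_exists_euclidean[OF scl real]] by blast
  have "linear (\<lambda>v. s.representation B v b)" for b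
  proof (rule linearI)
    show "s.representation B (v + w) b = s.representation B v b + s.representation B w b" for v w
      using B by (simp add: s.representation_add)
    show "s.representation B (r *\<^sub>R v) b = r *\<^sub>R s.representation B v b" for r v
      using B s.representation_scale[of B v "of_real r"] by (simp add: real scaleR_conv_of_real)
  qed
  then have "bounded_linear (\<lambda>v. s.representation B v b)" for b
    by (simp add: linear_conv_bounded_linear)
  then have "bounded_linear (\<lambda>t::'v \<Rightarrow>\<^sub>L 'v. s.representation B (blinfun_apply t b) b)" for b
    by (rule bounded_linear_compose) (rule blinfun.bounded_linear_left)
  then show ?thesis unfolding tr by (intro bounded_linear_sum)
qed

section \<open>Conjugation and real parts of scalars\<close>

lemma kconj_one [simp]: "kconj 1 = (1::'k::conj_division_algebra)"
proof -
  have "kconj 1 = kconj 1 * kconj (kconj (1::'k))" by (simp add: kconj_kconj)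
  also have "\<dots> = kconj (kconj 1 * 1)" by (simp only: kconj_mult)
  finally show ?thesis by (simp add: kconj_kconj)
qed

lemma kconj_zero [simp]: "kconj 0 = (0::'k::conj_division_algebra)"
  using kconj_add[of 0 0] by simp

lemma kconj_eq_0_iff [simp]: "kconj x = (0::'k::conj_division_algebra) \<longleftrightarrow> x = 0"
  by (metis kconj_kconj kconj_zero)

lemma kconj_of_real [simp]: "kconj (of_real r) = (of_real r::'k::conj_division_algebra)"
  by (simp add: of_real_def kconj_scaleR)

text \<open>
  Half of \<open>x + kconj x\<close>, as a real number: a conjugation-invariant scalar is real.
\<close>

definition kre :: "'k::conj_division_algebra \<Rightarrow> real" where
  "kre x = (THE r. x + kconj x = of_real (2 * r))"

lemma of_real_kre: "of_real (2 * kre x) = x + kconj (x::'k::conj_division_algebra)"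
proof -
  have "kconj (x + kconj x) = x + kconj x" by (simp add: kconj_add kconj_kconj add.commute)
  then obtain r where "x + kconj x = r *\<^sub>R 1" using kconj_fixed by blast
  then have "x + kconj x = of_real (2 * (r / 2))" by (simp add: of_real_def)
  then have "x + kconj x = of_real (2 * kre x)"
    unfolding kre_def by (rule theI) (metis \<open>x + kconj x = of_real (2 * (r / 2))\<close> mult_cancel_left of_real_eq_iff zero_neq_numeral)
  then show ?thesis by simp
qed

lemma kre_eqI: "x + kconj x = of_real (2 * r) \<Longrightarrow> kre x = r"
  using of_real_kre[of x] by (metis mult_cancel_left of_real_eq_iff zero_neq_numeral)

lemma kre_add: "kre (x + y) = kre x + kre y"
proof (rule kre_eqI)
  have "x + y + kconj (x + y) = (x + kconj x) + (y + kconj y)" by (simp add: kconj_add ac_simps)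
  also have "\<dots> = of_real (2 * (kre x + kre y))" by (simp only: of_real_kre[symmetric] of_real_add distrib_left)
  finally show "x + y + kconj (x + y) = of_real (2 * (kre x + kre y))" .
qed

lemma kre_scaleR: "kre (r *\<^sub>R x) = r * kre x"
proof (rule kre_eqI)
  have "r *\<^sub>R x + kconj (r *\<^sub>R x) = r *\<^sub>R of_real (2 * kre x)"
    by (simp only: kconj_scaleR of_real_kre scaleR_add_right)
  then show "r *\<^sub>R x + kconj (r *\<^sub>R x) = of_real (2 * (r * kre x))"
    by (simp only: scaleR_conv_of_real of_real_mult[symmetric] mult.left_commute)
qed

lemma kre_of_real [simp]: "kre (of_real r :: 'k::conj_division_algebra) = r"
  by (rule kre_eqI) (simp only: kconj_of_real mult_2 of_real_add)

lemma kre_diff: "kre (x - y) = kre x - kre y"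
  using kre_add[of "x - y" y] by simp

lemma kre_zero [simp]: "kre (0 :: 'k::conj_division_algebra) = 0"
  using kre_of_real[of 0, where 'k = 'k] by simp

lemma kre_kconj [simp]: "kre (kconj x) = kre x"
  by (rule kre_eqI) (simp only: kconj_kconj of_real_kre add.commute)

lemma of_real_kre_fixed:
  assumes "kconj x = (x::'k::conj_division_algebra)"
  shows "of_real (kre x) = x"
proof -
  obtain r where "x = of_real r" using kconj_fixed[OF assms] by (auto simp: of_real_def)
  then show ?thesis by simp
qed

text \<open>
  A nonzero difference could be multiplied by its inverse, giving real part one. Thus scalar
  identities may be tested on real parts, provided all right multiples are allowed.
\<close>

lemma eq_if_kre_multiples_eq:
  fixes x y :: "'k::conj_division_algebra"
  assumes "\<And>k. kre (x * k) = kre (y * k)"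
  shows "x = y"
proof (rule ccontr)
  assume "x \<noteq> y"
  then have "kre ((x - y) * inverse (x - y)) = 1"
    using kre_of_real[of 1, where 'k = 'k] by simp
  moreover have "kre ((x - y) * k) = 0" for k
    using assms[of k] by (simp add: left_diff_distrib kre_diff)
  ultimately show False by simp
qed

text \<open>
  The element \<open>kconj k * k\<close> is real, hence commutes with \<open>k\<close>; now cancel \<open>k\<close> on the right.
\<close>

lemma kconj_mult_commute: "kconj k * k = k * kconj (k::'k::conj_division_algebra)"
proof (cases "k = 0")
  case False
  have "kconj (kconj k * k) = kconj k * k" by (simp add: kconj_mult kconj_kconj)
  then obtain r where r: "kconj k * k = of_real r" using of_real_kre_fixed by metis
  have "k * kconj k * k = k * of_real r" by (simp add: mult.assoc r)
  also have "\<dots> = of_real r * k" by (simp add: of_real_def)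
  finally show ?thesis using False r by simp
qed simp

section \<open>The hermitian form and adjoints\<close>

context hermitian_space
begin

lemma act_one [simp]: "v \<cdot> 1 = v"
  using act_of_real[of v 1] by simp

lemma act_zero_right [simp]: "v \<cdot> 0 = 0"
  using act_add_right[of v 0 0] by simp

lemma act_scaleR_right: "v \<cdot> (r *\<^sub>R k) = r *\<^sub>R (v \<cdot> k)"
proof -
  have "v \<cdot> (k * of_real r) = r *\<^sub>R (v \<cdot> k)"
    by (simp only: act_act[symmetric] act_of_real)
  then show ?thesis by (simp add: of_real_def)
qed

lemma act_scaleR_left: "(r *\<^sub>R v) \<cdot> k = r *\<^sub>R (v \<cdot> k)"
proof -
  have "(r *\<^sub>R v) \<cdot> k = v \<cdot> (of_real r * k)"
    by (simp only: act_act[symmetric] act_of_real)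
  then show ?thesis by (simp add: of_real_def act_scaleR_right)
qed

lemma act_minus_left: "(- v) \<cdot> k = - (v \<cdot> k)"
  using act_scaleR_left[of "- 1" v k] by simp

lemma act_diff_left: "(v - w) \<cdot> k = v \<cdot> k - w \<cdot> k"
  using act_add_left[of v "- w" k] by (simp add: act_minus_left)

lemma bounded_linear_act_left: "bounded_linear (\<lambda>v. v \<cdot> k)"
  unfolding linear_conv_bounded_linear[symmetric]
  by (intro linearI) (simp_all add: act_add_left act_scaleR_left)

lemma form_scaleR_right: "\<langle>v, r *\<^sub>R w\<rangle> = r *\<^sub>R \<langle>v, w\<rangle>"
proof -
  have "\<langle>v, r *\<^sub>R w\<rangle> = \<langle>v, w\<rangle> * of_real r"
    by (simp only: form_act_right[symmetric] act_of_real)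
  then show ?thesis by (simp add: of_real_def)
qed

lemma form_scaleR_left: "\<langle>r *\<^sub>R v, w\<rangle> = r *\<^sub>R \<langle>v, w\<rangle>"
proof -
  have "\<langle>r *\<^sub>R v, w\<rangle> = kconj (of_real r) * \<langle>v, w\<rangle>"
    by (simp only: form_act_left[symmetric] act_of_real)
  then show ?thesis by (simp only: kconj_of_real) (simp add: of_real_def)
qed

lemma form_zero_left [simp]: "\<langle>0, v\<rangle> = 0"
  using form_add_left[of 0 0 v] by simp

lemma form_minus_right: "\<langle>v, - w\<rangle> = - \<langle>v, w\<rangle>"
  using form_scaleR_right[of v "- 1" w] by simp

lemma form_diff_right: "\<langle>v, w - w'\<rangle> = \<langle>v, w\<rangle> - \<langle>v, w'\<rangle>"
  using form_add_right[of v w "- w'"] by (simp add: form_minus_right)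

lemma form_minus_left: "\<langle>- v, w\<rangle> = - \<langle>v, w\<rangle>"
  using form_scaleR_left[of "- 1" v w] by simp

lemma form_diff_left: "\<langle>v - v', w\<rangle> = \<langle>v, w\<rangle> - \<langle>v', w\<rangle>"
  using form_add_left[of v "- v'" w] by (simp add: form_minus_left)

text \<open>
  The real part of the hermitian form is a symmetric bilinear form over the reals, and it is still
  nondegenerate. Passing to it replaces linear algebra over a possibly noncommutative
  scalar algebra by real linear algebra.
\<close>

definition real_form :: "'v \<Rightarrow> 'v \<Rightarrow> real" where
  "real_form v w = kre \<langle>v, w\<rangle>"

lemma bounded_bilinear_real_form: "bounded_bilinear real_form"
  unfolding bilinear_conv_bounded_bilinear[symmetric] bilinear_def real_form_def
  by (intro conjI allI linearI)
    (simp_all add: form_add_left form_add_right form_scaleR_left form_scaleR_right kre_add kre_scaleR)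

lemma form_eqI:
  assumes "\<And>u. real_form v u = real_form w u"
  shows "v = w"
proof -
  have "kre (\<langle>v - w, u\<rangle> * k) = kre (0 * k)" for u k
  proof -
    have "\<langle>v - w, u\<rangle> * k = \<langle>v, u \<cdot> k\<rangle> - \<langle>w, u \<cdot> k\<rangle>"
      by (simp only: form_act_right form_diff_left left_diff_distrib)
    then show ?thesis using assms[of "u \<cdot> k"] by (simp add: real_form_def kre_diff)
  qed
  then have "\<langle>v - w, u\<rangle> = 0" for u by (rule eq_if_kre_multiples_eq)
  then show ?thesis using form_nondegenerate[of "v - w"] by simp
qed

lemma real_form_commute: "real_form v w = real_form w v"
  using form_conj[of v w] by (simp add: real_form_def)

lemma form_self: "\<langle>p, p\<rangle> = of_real (real_form p p)"
  unfolding real_form_def using form_conj[of p p] by (simp add: of_real_kre_fixed)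

text \<open>
  Nondegeneracy makes the map from vectors to functionals injective, hence surjective, since both
  spaces have the same finite dimension. The map \<open>\<Phi>\<close> below is this one, with functionals identified with
  vectors by means of the inner product.
\<close>

lemma real_form_represents:
  assumes "linear (f :: 'v \<Rightarrow> real)"
  shows "\<exists>u. \<forall>v. real_form v u = f v"
proof -
  interpret R: bounded_bilinear real_form by (rule bounded_bilinear_real_form)
  define \<Phi> :: "'v \<Rightarrow> 'v" where "\<Phi> u = (\<Sum>b\<in>Basis. real_form b u *\<^sub>R b)" for u
  have \<Phi>: "\<Phi> u \<bullet> b = real_form b u" if "b \<in> Basis" for u b
    using that by (simp add: \<Phi>_def)
  have lin: "linear \<Phi>"
    by (intro linearI) (simp_all add: \<Phi>_def R.add_right R.scaleR_right algebra_simps sum.distrib scaleR_sum_right)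
  have "u = 0" if "\<Phi> u = 0" for u
  proof (rule form_eqI)
    have "(\<lambda>v. real_form v u) = (\<lambda>_. 0)"
    proof (rule linear_eq_stdbasis)
      show "linear (\<lambda>v. real_form v u)" by (rule bounded_linear.linear[OF R.bounded_linear_left])
      show "real_form b u = 0" if "b \<in> Basis" for b
        using \<Phi>[OF that, of u] \<open>\<Phi> u = 0\<close> by simp
    qed (rule linear_zero)
    then show "real_form u v = real_form 0 v" for v
      by (metis real_form_commute R.zero_left)
  qed
  then have "inj \<Phi>" using linear_injective_0[OF lin] by blast
  then have "surj \<Phi>" using lin linear_injective_imp_surjective by blast
  then obtain u where u: "\<Phi> u = (\<Sum>b\<in>Basis. f b *\<^sub>R b)" by (metis surjD)
  have "(\<lambda>v. real_form v u) = f"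
  proof (rule linear_eq_stdbasis)
    show "linear (\<lambda>v. real_form v u)" by (rule bounded_linear.linear[OF R.bounded_linear_left])
    show "real_form b u = f b" if "b \<in> Basis" for b
      using \<Phi>[OF that, of u] that by (simp add: u)
  qed (rule assms)
  then show ?thesis by metis
qed

definition dual_vector :: "'v \<Rightarrow> 'v" where
  "dual_vector b = (SOME u. \<forall>v. real_form v u = v \<bullet> b)"

lemma real_form_dual_vector: "real_form v (dual_vector b) = v \<bullet> b"
proof -
  have "\<exists>u. \<forall>v. real_form v u = v \<bullet> b"
    by (rule real_form_represents) (rule bounded_linear.linear[OF bounded_linear_inner_left])
  from someI_ex[OF this] show ?thesis by (simp add: dual_vector_def)
qed

text \<open>
  The adjoint for the real form, written out over the standard basis. It is defined for every real
  linear operator and depends on it linearly and continuously, so that it can be differentiated.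
  The adjoint for the hermitian form exists only for scalar-linear operators, and there the two agree.
\<close>

definition real_adjoint :: "('v \<Rightarrow>\<^sub>L 'v) \<Rightarrow> ('v \<Rightarrow>\<^sub>L 'v)" where
  "real_adjoint t = (\<Sum>b\<in>Basis.
     bounded_bilinear.prod_right (\<lambda>u w. real_form u w *\<^sub>R dual_vector b) (blinfun_apply t b))"

lemma bounded_bilinear_real_form_scaleR: "bounded_bilinear (\<lambda>u w. real_form u w *\<^sub>R (c::'v))"
  unfolding bilinear_conv_bounded_bilinear[symmetric] bilinear_def
  using bounded_bilinear.add_left[OF bounded_bilinear_real_form]
    bounded_bilinear.add_right[OF bounded_bilinear_real_form]
    bounded_bilinear.scaleR_left[OF bounded_bilinear_real_form]
    bounded_bilinear.scaleR_right[OF bounded_bilinear_real_form]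
  by (intro conjI allI linearI) (simp_all add: scaleR_add_left)

lemma real_adjoint_apply:
  "blinfun_apply (real_adjoint t) w =
    (\<Sum>b\<in>Basis. real_form (blinfun_apply t b) w *\<^sub>R dual_vector b)"
  by (simp add: real_adjoint_def blinfun.sum_left
      bounded_bilinear.prod_right.rep_eq[OF bounded_bilinear_real_form_scaleR])

lemma bounded_linear_real_adjoint: "bounded_linear real_adjoint"
  unfolding real_adjoint_def
  by (intro bounded_linear_sum bounded_linear_compose[OF
        bounded_bilinear.bounded_linear_prod_right[OF bounded_bilinear_real_form_scaleR]]
      blinfun.bounded_linear_left)

lemma real_form_real_adjoint:
  "real_form (blinfun_apply t v) w = real_form v (blinfun_apply (real_adjoint t) w)"
proof -
  interpret R: bounded_bilinear real_form by (rule bounded_bilinear_real_form)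
  have "real_form v (blinfun_apply (real_adjoint t) w) =
      (\<Sum>b\<in>Basis. (v \<bullet> b) * real_form (blinfun_apply t b) w)"
    by (simp add: real_adjoint_apply R.sum_right R.scaleR_right real_form_dual_vector mult.commute)
  also have "\<dots> = real_form (blinfun_apply t (\<Sum>b\<in>Basis. (v \<bullet> b) *\<^sub>R b)) w"
    by (simp add: blinfun.sum_right blinfun.scaleR_right R.sum_left R.scaleR_left)
  also have "\<dots> = real_form (blinfun_apply t v) w" by (simp only: euclidean_representation)
  finally show ?thesis by simp
qed

text \<open>
  It is enough to compare the real parts after multiplication by an arbitrary scalar \<open>k\<close>; linearity of
  \<open>t\<close> over the scalars moves \<open>k\<close> into the argument of \<open>t\<close>, where the real identity applies.
\<close>

lemma form_real_adjoint:
  assumes "klinear t"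
  shows "\<langle>blinfun_apply t v, w\<rangle> = \<langle>v, blinfun_apply (real_adjoint t) w\<rangle>" (is "?x = ?y")
proof -
  have "kre (kconj ?x * k) = kre (kconj ?y * k)" for k
  proof -
    have "kre (kconj ?x * k) = real_form w (blinfun_apply t (v \<cdot> k))"
      using assms by (simp add: real_form_def klinear_def form_act_right flip: form_conj)
    also have "\<dots> = real_form (blinfun_apply (real_adjoint t) w) (v \<cdot> k)"
      by (metis real_form_commute real_form_real_adjoint)
    also have "\<dots> = kre (kconj ?y * k)"
      by (simp add: real_form_def form_act_right flip: form_conj)
    finally show ?thesis .
  qed
  then have "kconj ?x = kconj ?y" by (rule eq_if_kre_multiples_eq)
  then show ?thesis by (metis kconj_kconj)
qed

lemma adjoint_unique:
  assumes "\<And>v w. \<langle>v, blinfun_apply s w\<rangle> = \<langle>v, blinfun_apply s' w\<rangle>"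
  shows "s = s'"
proof (rule blinfun_eqI, rule form_eqI)
  show "real_form (blinfun_apply s w) v = real_form (blinfun_apply s' w) v" for v w
    using assms[of v w] unfolding real_form_commute[of _ v] by (simp add: real_form_def)
qed

lemma hadjoint_eq_real_adjoint:
  assumes "klinear t"
  shows "hadjoint t = real_adjoint t"
  unfolding hadjoint_def
  by (rule the_equality) (auto simp: form_real_adjoint[OF assms] intro: adjoint_unique)

lemma klinear_real_adjoint:
  assumes "klinear t"
  shows "klinear (real_adjoint t)"
  unfolding klinear_def
proof (intro allI, rule form_eqI)
  fix w k v
  have "\<langle>v, blinfun_apply (real_adjoint t) (w \<cdot> k)\<rangle> = \<langle>v, blinfun_apply (real_adjoint t) w \<cdot> k\<rangle>"
    by (simp add: form_act_right flip: form_real_adjoint[OF assms])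
  then show "real_form (blinfun_apply (real_adjoint t) (w \<cdot> k)) v =
      real_form (blinfun_apply (real_adjoint t) w \<cdot> k) v"
    unfolding real_form_commute[of _ v] by (simp add: real_form_def)
qed

section \<open>Orthogonal projections\<close>

lemma proj_line_apply:
  "blinfun_apply (proj_line p) v = inverse (real_form p p) *\<^sub>R (p \<cdot> \<langle>p, v\<rangle>)"
proof -
  have div: "k / \<langle>p, p\<rangle> = inverse (real_form p p) *\<^sub>R k" for k
  proof -
    have "k / \<langle>p, p\<rangle> = k * of_real (inverse (real_form p p))"
      by (simp only: form_self divide_inverse of_real_inverse)
    then show ?thesis by (simp only: of_real_def mult_scaleR_right mult_1_right)
  qed
  have "linear (\<lambda>v. p \<cdot> (\<langle>p, v\<rangle> / \<langle>p, p\<rangle>))"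
    unfolding div act_scaleR_right
    by (intro linearI) (simp_all add: form_add_right act_add_right form_scaleR_right act_scaleR_right
        scaleR_add_right)
  then have "bounded_linear (\<lambda>v. p \<cdot> (\<langle>p, v\<rangle> / \<langle>p, p\<rangle>))"
    by (simp only: linear_conv_bounded_linear)
  then show ?thesis
    unfolding proj_line_def by (simp only: bounded_linear_Blinfun_apply div act_scaleR_right)
qed

lemma proj_perp_apply: "blinfun_apply (proj_perp p) v = v - blinfun_apply (proj_line p) v"
  by (simp add: proj_perp_def blinfun.diff_left)

lemma at_point_apply:
  "blinfun_apply (at_point p t) v =
    blinfun_apply (proj_perp p) (blinfun_apply t (blinfun_apply (proj_line p) v))"
  by (simp add: at_point_def)

lemma klinear_compose: "klinear s \<Longrightarrow> klinear t \<Longrightarrow> klinear (s o\<^sub>L t)"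
  by (simp add: klinear_def)

lemma klinear_proj_line: "klinear (proj_line p)"
  by (simp add: klinear_def proj_line_apply form_act_right act_scaleR_left act_act)

lemma klinear_proj_perp: "klinear (proj_perp p)"
  using klinear_proj_line by (simp add: klinear_def proj_perp_apply act_diff_left)

lemma klinear_at_point: "klinear t \<Longrightarrow> klinear (at_point p t)"
  unfolding at_point_def by (intro klinear_compose klinear_proj_line klinear_proj_perp)

lemma klinear_diff: "klinear s \<Longrightarrow> klinear t \<Longrightarrow> klinear (s - t)"
  by (simp add: klinear_def blinfun.diff_left act_diff_left)

lemma real_form_self_nonzero: "\<langle>p, p\<rangle> \<noteq> 0 \<Longrightarrow> real_form p p \<noteq> 0"
  using form_self[of p] by auto

lemma form_proj_line:
  assumes "\<langle>p, p\<rangle> \<noteq> 0"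
  shows "\<langle>p, blinfun_apply (proj_line p) v\<rangle> = \<langle>p, v\<rangle>"
proof -
  have "\<langle>p, blinfun_apply (proj_line p) v\<rangle> =
      inverse (real_form p p) *\<^sub>R (of_real (real_form p p) * \<langle>p, v\<rangle>)"
    by (simp only: proj_line_apply form_scaleR_right form_act_right form_self[symmetric])
  then show ?thesis
    using real_form_self_nonzero[OF assms] by (simp add: of_real_def)
qed

lemma form_proj_perp:
  assumes "\<langle>p, p\<rangle> \<noteq> 0"
  shows "\<langle>p, blinfun_apply (proj_perp p) v\<rangle> = 0"
  by (simp add: proj_perp_apply form_diff_right form_proj_line[OF assms])

lemma proj_line_orthogonal: "\<langle>p, v\<rangle> = 0 \<Longrightarrow> blinfun_apply (proj_line p) v = 0"
  by (simp add: proj_line_apply)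

lemma proj_perp_orthogonal: "\<langle>p, v\<rangle> = 0 \<Longrightarrow> blinfun_apply (proj_perp p) v = v"
  by (simp add: proj_perp_apply proj_line_orthogonal)

lemma proj_line_self:
  assumes "\<langle>p, p\<rangle> \<noteq> 0"
  shows "blinfun_apply (proj_line p) p = p"
  using real_form_self_nonzero[OF assms]
  by (simp add: proj_line_apply form_self[of p] act_of_real)

lemma proj_line_idem:
  assumes "\<langle>p, p\<rangle> \<noteq> 0"
  shows "proj_line p o\<^sub>L proj_line p = proj_line p"
  by (rule blinfun_eqI) (simp add: proj_line_apply[of p "blinfun_apply (proj_line p) _"]
      form_proj_line[OF assms], simp add: proj_line_apply)

lemma proj_perp_idem:
  assumes "\<langle>p, p\<rangle> \<noteq> 0"
  shows "proj_perp p o\<^sub>L proj_perp p = proj_perp p"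
  by (rule blinfun_eqI) (simp add: proj_perp_orthogonal form_proj_perp[OF assms])

lemma form_proj_line_commute:
  "\<langle>blinfun_apply (proj_line p) v, w\<rangle> = \<langle>v, blinfun_apply (proj_line p) w\<rangle>"
  by (simp add: proj_line_apply form_scaleR_left form_scaleR_right form_act_left form_act_right
      flip: form_conj)

lemma form_proj_perp_commute:
  "\<langle>blinfun_apply (proj_perp p) v, w\<rangle> = \<langle>v, blinfun_apply (proj_perp p) w\<rangle>"
  by (simp add: proj_perp_apply form_diff_left form_diff_right form_proj_line_commute)

lemma form_act_self_nonzero:
  assumes "\<langle>p, p\<rangle> \<noteq> 0" "k \<noteq> 0"
  shows "\<langle>p \<cdot> k, p \<cdot> k\<rangle> \<noteq> 0"
  using assms by (simp add: form_act_left form_act_right)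

text \<open>
  Both scalars produced by rescaling \<open>p\<close> lie next to each other, as \<open>k * kconj k\<close>, which is real and
  cancels against the change of \<open>\<langle>p, p\<rangle>\<close>.
\<close>

lemma proj_line_act:
  assumes p: "\<langle>p, p\<rangle> \<noteq> 0" and k: "k \<noteq> 0"
  shows "proj_line (p \<cdot> k) = proj_line p"
proof -
  have Q: "\<langle>p \<cdot> k, p \<cdot> k\<rangle> = real_form p p *\<^sub>R (kconj k * k)"
  proof -
    have "\<langle>p \<cdot> k, p \<cdot> k\<rangle> = kconj k * (of_real (real_form p p) * k)"
      by (simp only: form_act_left form_act_right form_self[symmetric] mult.assoc)
    then show ?thesis by (simp add: of_real_def)
  qed
  define n where "n = real_form (p \<cdot> k) (p \<cdot> k)"
  have n: "n \<noteq> 0" unfolding n_def by (intro real_form_self_nonzero form_act_self_nonzero p k)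
  have "of_real n = real_form p p *\<^sub>R (k * kconj k)"
    using Q unfolding n_def form_self[symmetric] kconj_mult_commute .
  then have kk: "k * kconj k = (inverse (real_form p p) * n) *\<^sub>R 1"
    using real_form_self_nonzero[OF p] by (metis of_real_def scaleR_scaleR left_inverse scaleR_one)
  show ?thesis
  proof (rule blinfun_eqI)
    fix v
    have "blinfun_apply (proj_line (p \<cdot> k)) v = inverse n *\<^sub>R (p \<cdot> (k * kconj k * \<langle>p, v\<rangle>))"
      by (simp only: proj_line_apply n_def form_act_left act_act mult.assoc)
    also have "\<dots> = blinfun_apply (proj_line p) v"
      unfolding kk using n by (simp add: act_scaleR_right proj_line_apply)
    finally show "blinfun_apply (proj_line (p \<cdot> k)) v = blinfun_apply (proj_line p) v" .
  qed
qed

lemma at_point_act: "\<langle>p, p\<rangle> \<noteq> 0 \<Longrightarrow> k \<noteq> 0 \<Longrightarrow> at_point (p \<cdot> k) t = at_point p t"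
  by (simp add: at_point_def proj_perp_def proj_line_act)

lemma bounded_linear_at_point: "bounded_linear (at_point p)"
  unfolding at_point_def
  by (intro bounded_linear_compose[OF bounded_bilinear.bounded_linear_left[OF bounded_bilinear_blinfun_compose]]
      bounded_bilinear.bounded_linear_right[OF bounded_bilinear_blinfun_compose])

lemma at_point_idem:
  assumes "\<langle>p, p\<rangle> \<noteq> 0"
  shows "at_point p (at_point p t) = at_point p t"
proof -
  have "at_point p (at_point p t) =
      (proj_perp p o\<^sub>L proj_perp p) o\<^sub>L t o\<^sub>L (proj_line p o\<^sub>L proj_line p)"
    by (rule blinfun_eqI) (simp add: at_point_def)
  then show ?thesis by (simp only: proj_perp_idem[OF assms] proj_line_idem[OF assms] at_point_def)
qed

lemma at_point_in_tangent_space: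
  assumes "\<langle>p, p\<rangle> \<noteq> 0" "klinear t"
  shows "at_point p t \<in> tangent_space p"
  using assms
  by (simp add: tangent_space_def klinear_at_point) (simp add: at_point_apply form_proj_perp proj_line_orthogonal)

text \<open>
  Columnwise, the projection is the quotient of an expression quadratic in \<open>p\<close> by the real number
  \<open>\<langle>p, p\<rangle>\<close>, which has no zeros on \<open>U\<close>.
\<close>

lemma smooth_on_proj_line:
  assumes U: "open U" and p: "\<And>p. p \<in> U \<Longrightarrow> \<langle>p, p\<rangle> \<noteq> 0"
  shows "smooth_on U proj_line"
proof (rule smooth_on_blinfunI[OF U])
  fix b :: 'v
  have "bounded_bilinear (\<lambda>p q. p \<cdot> \<langle>q, b\<rangle>)"
    unfolding bilinear_conv_bounded_bilinear[symmetric] bilinear_def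
    by (intro conjI allI linearI)
      (simp_all add: act_add_left act_scaleR_left form_add_left act_add_right form_scaleR_left act_scaleR_right)
  then show "smooth_on U (\<lambda>p. blinfun_apply (proj_line p) b)"
    unfolding proj_line_apply
    by (intro smooth_on_bilinear[OF bounded_bilinear_scaleR] smooth_on_inverse
        smooth_on_bilinear[OF bounded_bilinear_real_form] smooth_on_bilinear[where B = "\<lambda>p q. p \<cdot> \<langle>q, b\<rangle>"]
        smooth_on_ident U real_form_self_nonzero p)
qed

lemma smooth_on_at_point:
  assumes U: "open U" and p: "\<And>p. p \<in> U \<Longrightarrow> \<langle>p, p\<rangle> \<noteq> 0" and Z: "smooth_on U Z"
  shows "smooth_on U (\<lambda>p. at_point p (Z p))"
  unfolding at_point_def proj_perp_def
  by (intro smooth_on_bilinear[OF bounded_bilinear_blinfun_compose] smooth_on_diff smooth_on_const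
      smooth_on_proj_line U p Z)

section \<open>Derivatives of lifted fields\<close>

lemma regionD:
  assumes "region U" "p \<in> U"
  shows "open U" "\<langle>p, p\<rangle> \<noteq> 0" "k \<noteq> 0 \<Longrightarrow> p \<cdot> k \<in> U"
  using assms by (auto simp: region_def)

lemma lifted_fieldD:
  assumes "lifted_field U X"
  shows "smooth_on U X"
    and "p \<in> U \<Longrightarrow> klinear (X p)"
    and "p \<in> U \<Longrightarrow> at_point p (X p) = X p"
    and "p \<in> U \<Longrightarrow> k \<noteq> 0 \<Longrightarrow> X (p \<cdot> k) = X p"
    and "p \<in> U \<Longrightarrow> (X has_derivative frechet_derivative X (at p)) (at p)"
  using assms smooth_on_imp_has_derivative[of U X p] by (auto simp: lifted_field_def)

lemma tderiv_eq:
  assumes "(f has_derivative f') (at p)"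
  shows "tderiv p t f = f' (blinfun_apply t p)"
  unfolding tderiv_def by (rule vector_derivative_at[OF has_vector_derivative_along_line[OF assms]])

text \<open>
  The covariant derivative is the tangent part of the ordinary derivative of the lift in the
  direction \<open>t p\<close>.
\<close>

lemma nabla_eq:
  assumes "(X has_derivative X') (at p)"
  shows "nabla p t X = at_point p (X' (blinfun_apply t p))"
proof -
  have "blinfun_apply (id_blinfun + \<epsilon> *\<^sub>R t) p = p + \<epsilon> *\<^sub>R blinfun_apply t p" for \<epsilon>
    by (simp add: blinfun.add_left blinfun.scaleR_left)
  then show ?thesis
    unfolding nabla_def
    using vector_derivative_at[OF has_vector_derivative_along_line[OF assms]] by simp
qed

text \<open>
  Linearity over the scalars is a system of continuous real linear equations in the operator, and
  such equations survive differentiation.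
\<close>

lemma klinear_derivative:
  assumes U: "open U" "p \<in> U" and X: "\<And>q. q \<in> U \<Longrightarrow> klinear (X q)"
    and D: "(X has_derivative X') (at p)"
  shows "klinear (X' v)"
  unfolding klinear_def
proof (intro allI)
  fix w k
  define L :: "('v \<Rightarrow>\<^sub>L 'v) \<Rightarrow> 'v"
    where "L t = blinfun_apply t (w \<cdot> k) - blinfun_apply t w \<cdot> k" for t
  have "bounded_linear L"
    unfolding L_def
    by (intro bounded_linear_sub blinfun.bounded_linear_left
        bounded_linear_compose[OF bounded_linear_act_left])
  then have "((\<lambda>q. L (X q)) has_derivative (\<lambda>v. L (X' v))) (at p)"
    using D by (rule bounded_linear.has_derivative)
  moreover have "((\<lambda>q. L (X q)) has_derivative (\<lambda>v. 0)) (at p)"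
    by (rule has_derivative_transform_within_open[OF has_derivative_const U])
      (use X in \<open>simp add: L_def klinear_def\<close>)
  ultimately have "(\<lambda>v. L (X' v)) = (\<lambda>v. 0)" by (rule has_derivative_unique)
  then have "L (X' v) = 0" by (rule fun_cong)
  then show "blinfun_apply (X' v) (w \<cdot> k) = blinfun_apply (X' v) w \<cdot> k" by (simp add: L_def)
qed

text \<open>
  Chain rule for the rescaling \<open>q \<mapsto> q \<cdot> k\<close>, which leaves \<open>X\<close> invariant.
\<close>

lemma derivative_act:
  assumes U: "open U" "p \<in> U" and X: "\<And>q. q \<in> U \<Longrightarrow> X (q \<cdot> k) = X q"
    and D: "(X has_derivative X') (at p)" and Dk: "(X has_derivative X'') (at (p \<cdot> k))"
  shows "X'' (v \<cdot> k) = X' v"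
proof -
  have "((\<lambda>q. X (q \<cdot> k)) has_derivative (\<lambda>v. X'' (v \<cdot> k))) (at p)"
    using bounded_linear_imp_has_derivative[OF bounded_linear_act_left] Dk
    by (rule has_derivative_compose)
  then have "(X has_derivative (\<lambda>v. X'' (v \<cdot> k))) (at p)"
    by (rule has_derivative_transform_within_open[OF _ U]) (rule X)
  from has_derivative_unique[OF this D] show ?thesis by (rule fun_cong)
qed

text \<open>
  The curve \<open>p + \<epsilon> (p \<cdot> k)\<close> equals \<open>p \<cdot> (1 + \<epsilon> k)\<close>, so for small \<open>\<epsilon>\<close> it represents one and the same
  point of the projective space.
\<close>

lemma derivative_along_line_zero:
  assumes W: "region W" "p \<in> W" and f: "\<And>q k. q \<in> W \<Longrightarrow> k \<noteq> 0 \<Longrightarrow> f (q \<cdot> k) = f q"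
    and D: "(f has_derivative f') (at p)"
  shows "f' (p \<cdot> k) = 0"
proof -
  let ?S = "(\<lambda>\<epsilon>::real. p + \<epsilon> *\<^sub>R (p \<cdot> k)) -` W"
  have S: "open ?S" "0 \<in> ?S"
    using regionD[OF W] W(2) by (auto intro!: open_vimage continuous_intros)
  have const: "f p = f (p + \<epsilon> *\<^sub>R (p \<cdot> k))" if "\<epsilon> \<in> ?S" for \<epsilon>
  proof -
    have eq: "p + \<epsilon> *\<^sub>R (p \<cdot> k) = p \<cdot> (1 + \<epsilon> *\<^sub>R k)" by (simp add: act_add_right act_scaleR_right)
    then have "\<langle>p \<cdot> (1 + \<epsilon> *\<^sub>R k), p \<cdot> (1 + \<epsilon> *\<^sub>R k)\<rangle> \<noteq> 0"
      using that regionD(2)[OF W(1), of "p + \<epsilon> *\<^sub>R (p \<cdot> k)"] by simp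
    then have "1 + \<epsilon> *\<^sub>R k \<noteq> 0" by (metis act_zero_right form_zero_left)
    then show ?thesis unfolding eq by (rule f[OF W(2), symmetric])
  qed
  have "((\<lambda>\<epsilon>. f (p + \<epsilon> *\<^sub>R (p \<cdot> k))) has_vector_derivative 0) (at 0)"
    by (rule has_vector_derivative_transform_within_open[OF has_vector_derivative_const S])
      (rule const)
  with has_vector_derivative_along_line[OF D, of "p \<cdot> k"] show ?thesis
    by (rule vector_derivative_unique_at)
qed

text \<open>
  Invariance under rescaling of \<open>p\<close> holds because the direction \<open>Y(p) p\<close> is rescaled by the same
  scalar, while the derivative of \<open>X\<close> at \<open>p \<cdot> k\<close> in the direction \<open>v \<cdot> k\<close> is its derivative at \<open>p\<close> in the
  direction \<open>v\<close>.
\<close>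

lemma lifted_field_nabla:
  assumes U: "region U" and X: "lifted_field U X" and Y: "lifted_field U Y"
  shows "lifted_field U (\<lambda>p. nabla p (Y p) X)"
proof -
  have oU: "open U" and pU: "\<And>p. p \<in> U \<Longrightarrow> \<langle>p, p\<rangle> \<noteq> 0" using U by (auto simp: region_def)
  let ?N = "\<lambda>p. at_point p (frechet_derivative X (at p) (blinfun_apply (Y p) p))"
  have N: "nabla p (Y p) X = ?N p" if "p \<in> U" for p
    by (rule nabla_eq[OF lifted_fieldD(5)[OF X that]])
  have kl: "klinear (frechet_derivative X (at p) v)" if "p \<in> U" for p v
    by (rule klinear_derivative[OF oU that lifted_fieldD(2)[OF X] lifted_fieldD(5)[OF X that]])
  have smooth: "smooth_on U ?N"
    by (intro smooth_on_at_point smooth_on_derivative_along_field oU pU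
        smooth_on_bilinear[OF bounded_bilinear_blinfun_apply] smooth_on_ident
        lifted_fieldD(1)[OF X] lifted_fieldD(1)[OF Y])
  have "smooth_on U (\<lambda>p. nabla p (Y p) X)"
    by (rule smooth_on_cong[OF oU _ smooth]) (rule N[symmetric])
  moreover have "klinear (nabla p (Y p) X)" if "p \<in> U" for p
    unfolding N[OF that] by (rule klinear_at_point[OF kl[OF that]])
  moreover have "at_point p (nabla p (Y p) X) = nabla p (Y p) X" if "p \<in> U" for p
    unfolding N[OF that] by (rule at_point_idem[OF pU[OF that]])
  moreover have "nabla (p \<cdot> k) (Y (p \<cdot> k)) X = nabla p (Y p) X" if p: "p \<in> U" and k: "k \<noteq> 0" for p k
  proof -
    have pk: "p \<cdot> k \<in> U" by (rule regionD(3)[OF U p k])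
    have "blinfun_apply (Y (p \<cdot> k)) (p \<cdot> k) = blinfun_apply (Y p) p \<cdot> k"
      using lifted_fieldD(2)[OF Y p] by (simp add: lifted_fieldD(4)[OF Y p k] klinear_def)
    moreover have "frechet_derivative X (at (p \<cdot> k)) (v \<cdot> k) = frechet_derivative X (at p) v" for v
      by (rule derivative_act[OF oU p lifted_fieldD(4)[OF X _ k]
            lifted_fieldD(5)[OF X p] lifted_fieldD(5)[OF X pk]])
    ultimately show ?thesis
      unfolding N[OF p] N[OF pk] by (simp only: at_point_act[OF pU[OF p] k])
  qed
  ultimately show ?thesis unfolding lifted_field_def by blast
qed

lemma lifted_field_diff:
  assumes U: "open U" and X: "lifted_field U X" and Y: "lifted_field U Y"
  shows "lifted_field U (\<lambda>p. X p - Y p)"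
  using X Y
  by (auto simp: lifted_field_def smooth_on_diff[OF U] klinear_diff
      linear_diff[OF bounded_linear.linear[OF bounded_linear_at_point]])

section \<open>The Levi-Civita property\<close>

text \<open>
  Everything is inherited from the ordinary derivative. In the Leibniz rule, the term in which \<open>f\<close> is
  differentiated is the multiple of \<open>X(p)\<close> and is not affected by taking the tangent part.
\<close>

lemma affine_connection_nabla: "affine_connection M nabla"
  unfolding affine_connection_def
proof (intro allI impI conjI ballI; elim conjE)
  fix U X
  assume U: "region U" and X: "lifted_field U X"
  show "lifted_field U (\<lambda>p. nabla p (Y p) X)" if "lifted_field U Y" for Y
    by (rule lifted_field_nabla[OF U X that])
  fix p t
  assume p: "p \<in> U" and t: "t \<in> tangent_space p"
  note oU = regionD(1)[OF U p] and p0 = regionD(2)[OF U p]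
  let ?X' = "frechet_derivative X (at p)"
  have DX: "(X has_derivative ?X') (at p)" by (rule lifted_fieldD(5)[OF X p])
  interpret X': linear ?X' by (rule has_derivative_linear[OF DX])
  interpret at_p: bounded_linear "at_point p" by (rule bounded_linear_at_point)
  show "nabla p t X \<in> tangent_space p"
    unfolding nabla_eq[OF DX]
    by (rule at_point_in_tangent_space[OF p0 klinear_derivative[OF oU p lifted_fieldD(2)[OF X] DX]])
  show "nabla p (s + t) X = nabla p s X + nabla p t X" for s
    by (simp add: nabla_eq[OF DX] blinfun.add_left X'.add at_p.add)
  show "nabla p (a *\<^sub>R t) X = a *\<^sub>R nabla p t X" for a
    by (simp add: nabla_eq[OF DX] blinfun.scaleR_left X'.scale at_p.scaleR)
  show "nabla p t (\<lambda>q. X q + Z q) = nabla p t X + nabla p t Z" if "lifted_field U Z" for Z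
  proof -
    have DZ: "(Z has_derivative frechet_derivative Z (at p)) (at p)" by (rule lifted_fieldD(5)[OF that p])
    show ?thesis
      unfolding nabla_eq[OF DX] nabla_eq[OF DZ] nabla_eq[OF has_derivative_add[OF DX DZ]] by (rule at_p.add)
  qed
  show "nabla p t (\<lambda>q. f q *\<^sub>R X q) = tderiv p t f *\<^sub>R X p + f p *\<^sub>R nabla p t X"
    if "smooth_function U f" for f
  proof -
    have Df: "(f has_derivative frechet_derivative f (at p)) (at p)"
      using that p by (auto simp: smooth_function_def intro: smooth_on_imp_has_derivative)
    show ?thesis
      unfolding nabla_eq[OF DX] tderiv_eq[OF Df] nabla_eq[OF has_derivative_scaleR[OF Df DX]]
      by (simp add: at_p.add at_p.scaleR lifted_fieldD(3)[OF X p])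
  qed
  show "nabla p t Z = nabla p t X" if "lifted_field U Z" "\<forall>q\<in>U. Z q = X q" for Z
  proof -
    have "(Z has_derivative ?X') (at p)"
      by (rule has_derivative_transform_within_open[OF DX oU p]) (use that in simp)
    then show ?thesis by (simp only: nabla_eq[OF DX] nabla_eq)
  qed
qed

text \<open>
  For the lifts, differentiating \<open>f\<close> along \<open>T\<close> and then along \<open>S\<close> produces the Hessian at \<open>S p\<close> and
  \<open>T p\<close>, the derivative of \<open>f\<close> along \<open>DT(S p) p\<close>, and its derivative along \<open>T (S p)\<close>. The Hessian is
  symmetric, the last term vanishes because \<open>S p\<close> lies in \<open>p\<^sup>\<bottom>\<close>, and in the middle term \<open>DT(S p)\<close> may be
  replaced by its tangent part, since \<open>f\<close> is constant along the line of \<open>p\<close>.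
\<close>

lemma torsion_free_nabla: "torsion_free M nabla"
  unfolding torsion_free_def is_lie_bracket_def
proof (intro allI impI conjI ballI; elim conjE)
  fix U S T
  assume U: "region U" and S: "lifted_field U S" and T: "lifted_field U T"
  have oU: "open U" using U by (simp add: region_def)
  show "lifted_field U (\<lambda>p. nabla p (S p) T - nabla p (T p) S)"
    by (intro lifted_field_diff oU lifted_field_nabla U S T)
  fix W p and f :: "'v \<Rightarrow> real"
  assume W: "region W" "W \<subseteq> U" and f: "smooth_function W f" and p: "p \<in> W"
  have pU: "p \<in> U" using W(2) p by blast
  have oW: "open W" using W(1) by (simp add: region_def)
  have p0: "\<langle>p, p\<rangle> \<noteq> 0" by (rule regionD(2)[OF W(1) p])
  have fs: "smooth_on W f" and fk: "\<And>q k. q \<in> W \<Longrightarrow> k \<noteq> 0 \<Longrightarrow> f (q \<cdot> k) = f q"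
    using f by (auto simp: smooth_function_def)
  let ?f' = "frechet_derivative f (at p)"
  have Df: "(f has_derivative ?f') (at p)" by (rule smooth_on_imp_has_derivative[OF fs p])
  interpret f': linear ?f' by (rule has_derivative_linear[OF Df])
  \<comment> \<open>Only the component along the line of \<open>p\<close> is discarded, and \<open>f\<close> does not see it.\<close>
  have f'_at_point: "?f' (blinfun_apply (at_point p A) p) = ?f' (blinfun_apply A p)" for A
  proof -
    have "?f' (blinfun_apply (proj_line p) v) = 0" for v
      unfolding proj_line_apply f'.scale
      by (simp add: derivative_along_line_zero[OF W(1) p fk Df])
    then show ?thesis
      by (simp add: at_point_apply proj_line_self[OF p0] proj_perp_apply f'.diff)
  qed
  have iter: "tderiv p (Y p) (\<lambda>q. tderiv q (Z q) f) =
      ?f' (blinfun_apply (frechet_derivative Z (at p) (blinfun_apply (Y p) p)) p) +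
      frechet_derivative (\<lambda>q. frechet_derivative f (at q) (blinfun_apply (Z p) p)) (at p) (blinfun_apply (Y p) p)"
    if Y: "lifted_field U Y" and Z: "lifted_field U Z" for Y Z
  proof -
    let ?z' = "\<lambda>u. blinfun_apply (Z p) u + blinfun_apply (frechet_derivative Z (at p) u) p"
    have "((\<lambda>q. blinfun_apply (Z q) q) has_derivative ?z') (at p)"
      by (rule bounded_bilinear.FDERIV[OF bounded_bilinear_blinfun_apply lifted_fieldD(5)[OF Z pU] has_derivative_ident])
    note D = has_derivative_derivative_along_field[OF oW p fs this]
    have "((\<lambda>q. tderiv q (Z q) f) has_derivative
      (\<lambda>u. ?f' (?z' u) + frechet_derivative (\<lambda>q. frechet_derivative f (at q) (blinfun_apply (Z p) p)) (at p) u)) (at p)"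
      by (rule has_derivative_transform_within_open[OF D oW p])
        (simp add: tderiv_eq[OF smooth_on_imp_has_derivative[OF fs]])
    moreover have "blinfun_apply (Z p) (blinfun_apply (Y p) p) = 0"
    proof -
      have "blinfun_apply (proj_line p) (blinfun_apply (at_point p (Y p)) p) = 0"
        by (rule proj_line_orthogonal) (simp add: at_point_apply form_proj_perp[OF p0])
      then have "blinfun_apply (at_point p (Z p)) (blinfun_apply (at_point p (Y p)) p) = 0"
        unfolding at_point_apply[of p "Z p"] by simp
      then show ?thesis by (simp only: lifted_fieldD(3)[OF Y pU] lifted_fieldD(3)[OF Z pU])
    qed
    ultimately show ?thesis by (simp only: tderiv_eq add_0_left)
  qed
  have sym: "frechet_derivative (\<lambda>q. frechet_derivative f (at q) (blinfun_apply (T p) p)) (at p) (blinfun_apply (S p) p) =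
      frechet_derivative (\<lambda>q. frechet_derivative f (at q) (blinfun_apply (S p) p)) (at p) (blinfun_apply (T p) p)"
    by (rule second_derivative_symmetric[OF oW p fs])
  show "tderiv p (nabla p (S p) T - nabla p (T p) S) f =
      tderiv p (S p) (\<lambda>q. tderiv q (T q) f) - tderiv p (T p) (\<lambda>q. tderiv q (S q) f)"
    unfolding iter[OF S T] iter[OF T S] sym tderiv_eq[OF Df]
      nabla_eq[OF lifted_fieldD(5)[OF T pU]] nabla_eq[OF lifted_fieldD(5)[OF S pU]]
    by (simp add: blinfun.diff_left f'.diff f'_at_point)
qed

text \<open>
  The ordinary product rule gives the asserted formula with the derivatives of \<open>S\<close> and \<open>T\<close> in place of
  their tangent parts. Passing to the tangent part inserts a projection onto \<open>p\<close> and one onto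
  \<open>p\<^sup>\<bottom>\<close>; both are selfadjoint, and by the commutation property of \<open>\<tau>\<close> they can be moved next to the
  other factor, a tangent vector, which absorbs them. This uses only that \<open>\<tau>\<close> is continuous and
  linear over the reals and behaves like a trace, which covers the metric and the hermitian metric.
\<close>

lemma metric_compatible_nabla:
  fixes \<tau> :: "('v \<Rightarrow>\<^sub>L 'v) \<Rightarrow> 'w::real_normed_vector"
  assumes \<tau>: "bounded_linear \<tau>"
    and commute: "\<And>a b. klinear a \<Longrightarrow> klinear b \<Longrightarrow> \<tau> (a o\<^sub>L b) = \<tau> (b o\<^sub>L a)"
  shows "metric_compatible M (\<lambda>s t. \<tau> (hadjoint s o\<^sub>L t)) nabla"
  unfolding metric_compatible_def
proof (intro allI impI ballI; elim conjE)
  fix U S T p and v :: "'v \<Rightarrow>\<^sub>L 'v"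
  assume U: "region U" and S: "lifted_field U S" and T: "lifted_field U T" and p: "p \<in> U"
  let ?g = "\<lambda>s t. \<tau> (real_adjoint s o\<^sub>L t)"
  note oU = regionD(1)[OF U p] and p0 = regionD(2)[OF U p]
  let ?P = "proj_line p" and ?Q = "proj_perp p"
  have adj: "real_adjoint (at_point p s) = ?P o\<^sub>L (real_adjoint s o\<^sub>L ?Q)" if "klinear s" for s
    by (rule adjoint_unique)
      (simp add: form_real_adjoint[OF klinear_at_point[OF that], symmetric] at_point_apply
        form_proj_perp_commute form_real_adjoint[OF that] form_proj_line_commute)
  \<comment> \<open>The two ways in which tangent vectors absorb projections.\<close>
  have tangent: "?Q o\<^sub>L t = t" "t o\<^sub>L ?P = t" if "at_point p t = t" for t
  proof -
    have "?Q o\<^sub>L at_point p t = (?Q o\<^sub>L ?Q) o\<^sub>L t o\<^sub>L ?P"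
      by (rule blinfun_eqI) (simp add: at_point_def)
    then show "?Q o\<^sub>L t = t" unfolding proj_perp_idem[OF p0] at_point_def[symmetric] that .
    have "at_point p t o\<^sub>L ?P = ?Q o\<^sub>L t o\<^sub>L (?P o\<^sub>L ?P)"
      by (rule blinfun_eqI) (simp add: at_point_def)
    then show "t o\<^sub>L ?P = t" unfolding proj_line_idem[OF p0] at_point_def[symmetric] that .
  qed
  have left: "?g (at_point p s) t = ?g s t" if s: "klinear s" and t: "klinear t" "at_point p t = t" for s t
  proof -
    have "real_adjoint (at_point p s) o\<^sub>L t = ?P o\<^sub>L (real_adjoint s o\<^sub>L (?Q o\<^sub>L t))"
      unfolding adj[OF s] by (rule blinfun_eqI) simp
    then have "?g (at_point p s) t = \<tau> (?P o\<^sub>L (real_adjoint s o\<^sub>L t))"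
      by (simp only: tangent[OF t(2)])
    also have "\<dots> = \<tau> ((real_adjoint s o\<^sub>L t) o\<^sub>L ?P)"
      by (intro commute klinear_compose klinear_proj_line klinear_real_adjoint s t)
    also have "(real_adjoint s o\<^sub>L t) o\<^sub>L ?P = real_adjoint s o\<^sub>L (t o\<^sub>L ?P)"
      by (rule blinfun_eqI) simp
    finally show ?thesis by (simp only: tangent[OF t(2)])
  qed
  have right: "?g s (at_point p t) = ?g s t" if s: "klinear s" "at_point p s = s" and t: "klinear t" for s t
  proof -
    have s': "real_adjoint s = ?P o\<^sub>L (real_adjoint s o\<^sub>L ?Q)"
      using adj[OF s(1)] by (simp only: s(2))
    have sQ: "real_adjoint s o\<^sub>L ?Q = real_adjoint s"
    proof -
      have "(?P o\<^sub>L (real_adjoint s o\<^sub>L ?Q)) o\<^sub>L ?Q = ?P o\<^sub>L (real_adjoint s o\<^sub>L (?Q o\<^sub>L ?Q))"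
        by (rule blinfun_eqI) simp
      then show ?thesis unfolding proj_perp_idem[OF p0] s'[symmetric] .
    qed
    have Ps: "?P o\<^sub>L real_adjoint s = real_adjoint s"
      using s' unfolding sQ by (rule sym)
    have "real_adjoint s o\<^sub>L at_point p t = ((real_adjoint s o\<^sub>L ?Q) o\<^sub>L t) o\<^sub>L ?P"
      by (rule blinfun_eqI) (simp add: at_point_def)
    then have "?g s (at_point p t) = \<tau> ((real_adjoint s o\<^sub>L t) o\<^sub>L ?P)"
      by (simp only: sQ)
    also have "\<dots> = \<tau> (?P o\<^sub>L (real_adjoint s o\<^sub>L t))"
      by (intro commute klinear_compose klinear_proj_line klinear_real_adjoint s t)
    also have "?P o\<^sub>L (real_adjoint s o\<^sub>L t) = (?P o\<^sub>L real_adjoint s) o\<^sub>L t"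
      by (rule blinfun_eqI) simp
    finally show ?thesis by (simp only: Ps)
  qed
  let ?S' = "frechet_derivative S (at p)" and ?T' = "frechet_derivative T (at p)"
  let ?u = "blinfun_apply v p"
  note DS = lifted_fieldD(5)[OF S p] and DT = lifted_fieldD(5)[OF T p]
  have kS': "klinear (?S' w)" for w
    by (rule klinear_derivative[OF oU p lifted_fieldD(2)[OF S] DS])
  have kT': "klinear (?T' w)" for w
    by (rule klinear_derivative[OF oU p lifted_fieldD(2)[OF T] DT])
  have D1: "((\<lambda>q. real_adjoint (S q)) has_derivative (\<lambda>w. real_adjoint (?S' w))) (at p)"
    by (rule bounded_linear.has_derivative[OF bounded_linear_real_adjoint DS])
  have D2: "((\<lambda>q. real_adjoint (S q) o\<^sub>L T q) has_derivative
      (\<lambda>w. (real_adjoint (S p) o\<^sub>L ?T' w) + (real_adjoint (?S' w) o\<^sub>L T p))) (at p)"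
    by (rule bounded_bilinear.FDERIV[OF bounded_bilinear_blinfun_compose D1 DT])
  have "((\<lambda>q. ?g (S q) (T q)) has_derivative (\<lambda>w. \<tau> ((real_adjoint (S p) o\<^sub>L ?T' w) + (real_adjoint (?S' w) o\<^sub>L T p)))) (at p)"
    by (rule bounded_linear.has_derivative[OF \<tau> D2])
  then have "((\<lambda>q. \<tau> (hadjoint (S q) o\<^sub>L T q)) has_derivative (\<lambda>w. \<tau> ((real_adjoint (S p) o\<^sub>L ?T' w) + (real_adjoint (?S' w) o\<^sub>L T p)))) (at p)"
    by (rule has_derivative_transform_within_open[OF _ oU p])
      (simp add: hadjoint_eq_real_adjoint lifted_fieldD(2)[OF S])
  from tderiv_eq[OF this, of v]
  have "tderiv p v (\<lambda>q. \<tau> (hadjoint (S q) o\<^sub>L T q)) = ?g (?S' ?u) (T p) + ?g (S p) (?T' ?u)"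
    by (simp add: linear_add[OF bounded_linear.linear[OF \<tau>]] add.commute)
  also have "\<dots> = ?g (at_point p (?S' ?u)) (T p) + ?g (S p) (at_point p (?T' ?u))"
    by (simp only: left[OF kS' lifted_fieldD(2,3)[OF T p]] right[OF lifted_fieldD(2,3)[OF S p] kT'])
  also have "\<dots> = \<tau> (hadjoint (nabla p v S) o\<^sub>L T p) + \<tau> (hadjoint (S p) o\<^sub>L nabla p v T)"
    by (simp only: nabla_eq[OF DS] nabla_eq[OF DT] hadjoint_eq_real_adjoint[OF klinear_at_point[OF kS']]
        hadjoint_eq_real_adjoint[OF lifted_fieldD(2)[OF S p]])
  finally show "tderiv p v (\<lambda>q. \<tau> (hadjoint (S q) o\<^sub>L T q)) =
      \<tau> (hadjoint (nabla p v S) o\<^sub>L T p) + \<tau> (hadjoint (S p) o\<^sub>L nabla p v T)" .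
qed

lemma levi_civita_nabla:
  assumes "bounded_linear \<tau>"
    and "\<And>a b. klinear a \<Longrightarrow> klinear b \<Longrightarrow> \<tau> (a o\<^sub>L b) = \<tau> (b o\<^sub>L a)"
  shows "levi_civita M (\<lambda>s t. \<tau> (hadjoint s o\<^sub>L t)) nabla"
  unfolding levi_civita_def
  by (intro conjI affine_connection_nabla torsion_free_nabla metric_compatible_nabla assms)

lemma nabla_levi_civita_metric: "nabla_levi_civita metric"
  unfolding nabla_levi_civita_def
proof (intro ballI)
  fix C \<sigma>
  have scaleR: "vector_space (scaleR :: real \<Rightarrow> 'v \<Rightarrow> 'v)" by (rule real_vector.vector_space_axioms)
  let ?\<tau> = "\<lambda>t. \<sigma> * (trace_over scaleR (blinfun_apply (t :: 'v \<Rightarrow>\<^sub>L 'v)) / real (dim (UNIV :: 'k set)))"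
  have "levi_civita (cone C) (\<lambda>s t. ?\<tau> (hadjoint s o\<^sub>L t)) nabla"
  proof (rule levi_civita_nabla)
    show "bounded_linear ?\<tau>"
      by (intro bounded_linear_const_mult bounded_linear_divide[THEN bounded_linear_compose]
          bounded_linear_trace_over scaleR) simp
    have lin: "module_hom scaleR scaleR (blinfun_apply a)" for a :: "'v \<Rightarrow>\<^sub>L 'v"
      using scaleR by (auto simp: module_hom_def module_hom_axioms_def vector_space_def module_def
          blinfun.add_right blinfun.scaleR_right)
    show "?\<tau> (a o\<^sub>L b) = ?\<tau> (b o\<^sub>L a)" for a b
      using vector_space.trace_over_commute[OF scaleR finite_basis_exists_euclidean[OF scaleR] lin[of a] lin[of b]]
      by (simp add: blinfun_compose.rep_eq comp_def)
  qed
  then show "levi_civita (cone C) (metric \<sigma>) nabla"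
    by (simp add: metric_def[abs_def])
qed

end

context complex_hermitian_space
begin

lemma nabla_levi_civita_hermitian_metric: "nabla_levi_civita hermitian_metric"
  unfolding nabla_levi_civita_def
proof (intro ballI)
  fix C \<sigma>
  let ?scl = "\<lambda>k v. act v k"
  have scl: "vector_space ?scl"
    by unfold_locales (simp_all add: act_add_left act_add_right act_act mult.commute)
  have real: "?scl (of_real r) v = r *\<^sub>R v" for r v by (rule act_of_real)
  let ?\<tau> = "\<lambda>t. of_real \<sigma> * trace_over ?scl (blinfun_apply t)"
  have "levi_civita (cone C) (\<lambda>s t. ?\<tau> (hadjoint s o\<^sub>L t)) nabla"
  proof (rule levi_civita_nabla)
    show "bounded_linear ?\<tau>"
      by (intro bounded_linear_const_mult bounded_linear_trace_over scl real)
    have lin: "module_hom ?scl ?scl (blinfun_apply a)" if "klinear a" for a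
      using scl that by (auto simp: module_hom_def module_hom_axioms_def vector_space_def module_def
          blinfun.add_right klinear_def)
    show "?\<tau> (a o\<^sub>L b) = ?\<tau> (b o\<^sub>L a)" if "klinear a" "klinear b" for a b
      using vector_space.trace_over_commute[OF scl finite_basis_exists_euclidean[OF scl real]
          lin[OF that(1)] lin[OF that(2)]]
      by (simp add: blinfun_compose.rep_eq comp_def)
  qed
  then show "levi_civita (cone C) (hermitian_metric \<sigma>) nabla"
    by (simp add: hermitian_metric_def[abs_def])
qed

end

theorem proposition4p4:
  shows "(\<forall>(act :: 'v::euclidean_space \<Rightarrow> real \<Rightarrow> 'v) form.
            hermitian_space act form \<longrightarrow>
            hermitian_space.nabla_levi_civita act form (hermitian_space.metric form)) \<and>
         (\<forall>(act :: 'v \<Rightarrow> complex \<Rightarrow> 'v) form.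
            hermitian_space act form \<longrightarrow>
            hermitian_space.nabla_levi_civita act form (hermitian_space.metric form) \<and>
            hermitian_space.nabla_levi_civita act form
              (complex_hermitian_space.hermitian_metric act form)) \<and>
         (\<forall>(act :: 'v \<Rightarrow> quat \<Rightarrow> 'v) form.
            hermitian_space act form \<longrightarrow>
            hermitian_space.nabla_levi_civita act form (hermitian_space.metric form))"
  by (intro conjI allI impI hermitian_space.nabla_levi_civita_metric
      complex_hermitian_space.nabla_levi_civita_hermitian_metric
      complex_hermitian_space.intro)

end
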